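(* Let $\alpha_0,\alpha_1,\alpha_2,\alpha_3$ be complex parameters with $\alpha_0+2\alpha_1+2\alpha_2+\alpha_3=1$. Let $K\in\mathbb{C}(t)[x,y,z,w]$ and consider the polynomial Hamiltonian system with Hamiltonian $K$. Assume: (1) $\deg(K)=6$ with respect to $x,y,z,w$. (2) The system becomes again a polynomial Hamiltonian system in each of the coordinate systems $r_i=(x_i,y_i,z_i,w_i)$, $i=0,1,2,3$: $$\begin{aligned} r_0:\;&x_0=x+\tfrac{\alpha_0}{y}+\tfrac{1}{y^2},\ y_0=y,\ z_0=z,\ w_0=w, \\ r_1:\;&x_1=-(xy-\alpha_1)y,\ y_1=\tfrac{1}{y},\ z_1=z,\ w_1=w, \\ r_2:\;&x_2=\tfrac{1}{x},\ y_2=-\left((y+w^2-t)x+\alpha_2 \right)x,\ z_2=z-2xw,\ w_2=w,\\ r_3:\;&x_3=x,\ y_3=y,\ z_3=-(zw-\alpha_3)w,\ w_3=\tfrac{1}{w}; \end{aligned}$$ that is, $K$ expressed in the coordinates $r_j$ is a polynomial in $x_j,y_j,z_j,w_j$ over $\mathbb{C}(t)$ for $j=0,1,3$, and $K+x$ expressed in the coordinates $r_2$ is a polynomial in $x_2,y_2,z_2,w_2$ over $\mathbb{C}(t)$. Then the system coincides with the Hamiltonian system with Hamiltonian $H$ given by $$\begin{aligned} t^2H =\;&x^2y^3-(tx+2\alpha_1+\alpha_2+\alpha_3)xy^2-\{(\alpha_0 t-1)x-\alpha_1(\alpha_1+\alpha_2+\alpha_3)\}y-tx\\ &-\frac{z^2w^4}{4}+\frac{\alpha_3}{2}zw^3+\frac{1}{4}(2tz^2-\alpha_3^2)w^2-\frac{1}{2}\{(\alpha_3+1)t-1\}zw-\frac{t^2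 z^2}{4}\\ &+(xy-\alpha_1)yzw. \end{aligned}$$
   Context: The Hamiltonian system with Hamiltonian $K\in\mathbb{C}(t)[x,y,z,w]$ is $\frac{dx}{dt}=\frac{\partial K}{\partial y}$, $\frac{dy}{dt}=-\frac{\partial K}{\partial x}$, $\frac{dz}{dt}=\frac{\partial K}{\partial w}$, $\frac{dw}{dt}=-\frac{\partial K}{\partial z}$. Two Hamiltonian systems coincide if these differential equations are the same. Coefficients in $\mathbb{C}(t)$ are rational functions of $t$. *)

theory Defs
  imports
    "HOL-Library.Poly_Mapping"
    "HOL-Computational_Algebra.Polynomial"
    "HOL-Computational_Algebra.Fraction_Field"
begin

datatype pvar = VX | VY | VZ | VW

fun pvar_index :: "pvar \<Rightarrow> nat" where
  "pvar_index VX = 0"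
| "pvar_index VY = 1"
| "pvar_index VZ = 2"
| "pvar_index VW = 3"

lemma pvar_index_inject: "pvar_index u = pvar_index v \<longleftrightarrow> u = v"
  by (cases u; cases v) simp_all

(* The order on the variables serves only to make polynomials over an integral domain an
   instance of idom (see Poly_Mapping), so that their field of fractions can be formed. *)
instantiation pvar :: linorder
begin

definition less_eq_pvar :: "pvar \<Rightarrow> pvar \<Rightarrow> bool" where
  "u \<le> v \<longleftrightarrow> pvar_index u \<le> pvar_index v"

definition less_pvar :: "pvar \<Rightarrow> pvar \<Rightarrow> bool" where
  "u < v \<longleftrightarrow> pvar_index u < pvar_index v"

instance
  by standard (auto simp: less_eq_pvar_def less_pvar_def pvar_index_inject)

end

(* Polynomials in x, y, z, w: finitely supported maps from exponent vectors to coefficients,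
   with the convolution product of Poly_Mapping. *)
type_synonym 'a poly4 = "(pvar \<Rightarrow>\<^sub>0 nat) \<Rightarrow>\<^sub>0 'a"

definition Const :: "'a::zero \<Rightarrow> 'a poly4" where
  "Const c = Poly_Mapping.single 0 c"

definition Var :: "pvar \<Rightarrow> 'a::zero_neq_one poly4" where
  "Var v = Poly_Mapping.single (Poly_Mapping.single v 1) 1"

(* The inserted 0 only matters for the zero polynomial, which gets degree 0. *)
definition total_degree :: "'a::zero poly4 \<Rightarrow> nat" where
  "total_degree p =
     Max (insert 0 ((\<lambda>m. \<Sum>v\<in>Poly_Mapping.keys m. Poly_Mapping.lookup m v)
                      ` Poly_Mapping.keys p))"

(* If v does not occur in m, the truncated exponent is harmless: the coefficient is 0. *)
definition partial :: "pvar \<Rightarrow> 'a::comm_ring_1 poly4 \<Rightarrow> 'a poly4" where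
  "partial v p =
     (\<Sum>m\<in>Poly_Mapping.keys p. Poly_Mapping.single (m - Poly_Mapping.single v 1)
                    (of_nat (Poly_Mapping.lookup m v) * Poly_Mapping.lookup p m))"

definition ham_system ::
    "'a::comm_ring_1 poly4 \<Rightarrow> 'a poly4 \<times> 'a poly4 \<times> 'a poly4 \<times> 'a poly4" where
  "ham_system K = (partial VY K, - partial VX K, partial VW K, - partial VZ K)"

definition to_fract4 :: "'a::idom poly4 \<Rightarrow> 'a poly4 fract" where
  "to_fract4 p = Fract p 1"

definition subst4 :: "'a::idom poly4 \<Rightarrow> (pvar \<Rightarrow> 'a poly4 fract) \<Rightarrow> 'a poly4 fract" where
  "subst4 P r =
     (\<Sum>m\<in>Poly_Mapping.keys P.
        to_fract4 (Const (Poly_Mapping.lookup P m)) *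
        (\<Prod>v\<in>Poly_Mapping.keys m. r v ^ Poly_Mapping.lookup m v))"

(* The new coordinates r are given as rational functions of x, y, z, w.  A function F of
   x, y, z, w, when expressed in the coordinates r, is a polynomial in these iff
   F = P(r(x, y, z, w)) holds in the field of rational functions for some polynomial P. *)
definition polynomial_in_coords ::
    "'a::idom poly4 \<Rightarrow> (pvar \<Rightarrow> 'a poly4 fract) \<Rightarrow> bool" where
  "polynomial_in_coords F r \<longleftrightarrow> (\<exists>P. to_fract4 F = subst4 P r)"

(* The field of rational functions in t, and its elements c and t. *)
type_synonym ratt = "complex poly fract"

definition cst :: "complex \<Rightarrow> ratt" where
  "cst c = Fract [:c:] 1"

definition tvar :: ratt where
  "tvar = Fract [:0, 1:] 1"

definition coords :: "'b \<Rightarrow> 'b \<Rightarrow> 'b \<Rightarrow> 'b \<Rightarrow> pvar \<Rightarrow> 'b" where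
  "coords a b c d v = (case v of VX \<Rightarrow> a | VY \<Rightarrow> b | VZ \<Rightarrow> c | VW \<Rightarrow> d)"

definition r0 :: "complex \<Rightarrow> pvar \<Rightarrow> ratt poly4 fract" where
  "r0 \<alpha>0 =
     (let x = to_fract4 (Var VX); y = to_fract4 (Var VY);
          z = to_fract4 (Var VZ); w = to_fract4 (Var VW);
          a0 = to_fract4 (Const (cst \<alpha>0))
      in coords (x + a0 / y + 1 / y ^ 2) y z w)"

definition r1 :: "complex \<Rightarrow> pvar \<Rightarrow> ratt poly4 fract" where
  "r1 \<alpha>1 =
     (let x = to_fract4 (Var VX); y = to_fract4 (Var VY);
          z = to_fract4 (Var VZ); w = to_fract4 (Var VW);
          a1 = to_fract4 (Const (cst \<alpha>1))
      in coords (- (x * y - a1) * y) (1 / y) z w)"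

definition r2 :: "complex \<Rightarrow> pvar \<Rightarrow> ratt poly4 fract" where
  "r2 \<alpha>2 =
     (let x = to_fract4 (Var VX); y = to_fract4 (Var VY);
          z = to_fract4 (Var VZ); w = to_fract4 (Var VW);
          t = to_fract4 (Const tvar); a2 = to_fract4 (Const (cst \<alpha>2))
      in coords (1 / x) (- ((y + w ^ 2 - t) * x + a2) * x) (z - 2 * x * w) w)"

definition r3 :: "complex \<Rightarrow> pvar \<Rightarrow> ratt poly4 fract" where
  "r3 \<alpha>3 =
     (let x = to_fract4 (Var VX); y = to_fract4 (Var VY);
          z = to_fract4 (Var VZ); w = to_fract4 (Var VW);
          a3 = to_fract4 (Const (cst \<alpha>3))
      in coords x y (- (z * w - a3) * w) (1 / w))"

definition hamH :: "complex \<Rightarrow> complex \<Rightarrow> complex \<Rightarrow> complex \<Rightarrow> ratt poly4" where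
  "hamH \<alpha>0 \<alpha>1 \<alpha>2 \<alpha>3 =
     (let x = Var VX; y = Var VY; z = Var VZ; w = Var VW; t = Const tvar;
          a0 = Const (cst \<alpha>0); a1 = Const (cst \<alpha>1);
          a2 = Const (cst \<alpha>2); a3 = Const (cst \<alpha>3);
          half = Const (1 / 2); quarter = Const (1 / 4)
      in Const (1 / tvar ^ 2) *
         (x ^ 2 * y ^ 3 - (t * x + 2 * a1 + a2 + a3) * x * y ^ 2
          - ((a0 * t - 1) * x - a1 * (a1 + a2 + a3)) * y - t * x
          - quarter * z ^ 2 * w ^ 4 + half * a3 * z * w ^ 3
          + quarter * (2 * t * z ^ 2 - a3 ^ 2) * w ^ 2
          - half * ((a3 + 1) * t - 1) * z * w - quarter * t ^ 2 * z ^ 2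
          + (x * y - a1) * y * z * w))"

end

theory Submission
  imports Defs
begin

text \<open>
  The chart conditions are affine-linear in \<open>K\<close>, and it is shown that among the polynomials of degree at most
  6 they leave only \<open>K = H + c\<close> with \<open>c\<close> free of \<open>x\<close>, \<open>y\<close>, \<open>z\<close>, \<open>w\<close>. Such a \<open>c\<close> does not affect
  the system.

  Being polynomial in the coordinates of a chart means that, after the inverse substitution, the
  Laurent expansion of \<open>K\<close> along the divisor where the substitution has its pole contains no
  negative powers. Three of these conditions concern pairs of variables. For \<open>r1\<close> (in \<open>x\<close>, \<open>y\<close>) and
  \<open>r3\<close> (in \<open>z\<close>, \<open>w\<close>), a family of coefficients \<open>g a (a + m)\<close>, read as a polynomial in \<open>u = x y\<close> or
  \<open>u = z w\<close>, must be divisible by \<open>(u - \<alpha>)^m\<close>; for \<open>r0\<close> there is a similar divisibility for the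
  weight \<open>2 a - b\<close>. Against the degree bound 6 this leaves, in \<open>x\<close> and \<open>y\<close>, only combinations of

    \<open>1\<close>,  \<open>x y^2 - \<alpha>1 y\<close>,  \<open>x + x^2 y^2 + \<alpha>0 x y\<close>,  \<open>x^2 y^3 + x y - \<alpha>1^2 y\<close>,  \<open>(x y^2 - \<alpha>1 y)^2\<close>

  (\<open>shift_relations\<close>, \<open>inversion_relations\<close> and \<open>normal_form\<close>), with coefficients that are
  polynomials in \<open>z\<close>, \<open>w\<close> restricted by \<open>r3\<close> and by the degree: 33 unknown coefficients in all.

  The remaining chart \<open>r2\<close> couples all variables. Its inverse sends \<open>x\<close> and \<open>z\<close> to infinity with
  simple poles while \<open>y\<close> tends to \<open>t - w^2\<close>. Annihilating the principal part of \<open>K + x\<close> on a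
  family of curves that cross this divisor determines all coefficients except the constant term
  (\<open>r2_chart_determines\<close>). The elimination rests on \<open>t \<noteq> 0\<close>, and its last step on
  \<open>\<alpha>0 + 2 \<alpha>1 + 2 \<alpha>2 + \<alpha>3 = 1\<close>, which makes the coefficient of \<open>x^2 y^3\<close> equal to \<open>1/t^2\<close>.

  Identities between rational functions are handled through their values: the base field is
  infinite, so polynomials can be compared at points, and in one variable at a time.
\<close>

section \<open>Values of polynomials and of rational functions\<close>

text \<open>
  Characteristic 0 makes the base field infinite, so that a polynomial over it is determined by
  its values, and it allows the division by the numerical factors that turn up below.
\<close>
instance fract :: ("{idom, ring_char_0}") field_char_0
proof
  show "inj (of_nat :: nat \<Rightarrow> 'a fract)"
  proof (rule injI)
    fix m n :: nat
    assume "(of_nat m :: 'a fract) = of_nat n"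
    then show "m = n"
      by (simp add: of_nat_fract eq_fract)
  qed
qed

definition monom_value :: "(pvar \<Rightarrow> 'a::comm_semiring_1) \<Rightarrow> (pvar \<Rightarrow>\<^sub>0 nat) \<Rightarrow> 'a" where
  "monom_value e m = (\<Prod>v\<in>{VX, VY, VZ, VW}. e v ^ Poly_Mapping.lookup m v)"

definition eval4 :: "'a::comm_ring_1 poly4 \<Rightarrow> (pvar \<Rightarrow> 'a) \<Rightarrow> 'a" where
  "eval4 P e = (\<Sum>m\<in>Poly_Mapping.keys P. Poly_Mapping.lookup P m * monom_value e m)"

lemma monom_value_add: "monom_value e (m + n) = monom_value e m * monom_value e n"
  by (simp add: monom_value_def lookup_add power_add prod.distrib)

lemma monom_value_0 [simp]: "monom_value e 0 = 1"
  by (simp add: monom_value_def)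

lemma monom_value_single [simp]: "monom_value e (Poly_Mapping.single v n) = e v ^ n"
  by (cases v) (simp_all add: monom_value_def lookup_single)

lemma monom_value_eq_prod_keys:
  "monom_value e m = (\<Prod>v\<in>Poly_Mapping.keys m. e v ^ Poly_Mapping.lookup m v)"
  unfolding monom_value_def
proof (rule prod.mono_neutral_right)
  show "Poly_Mapping.keys m \<subseteq> {VX, VY, VZ, VW}"
    using pvar.exhaust by blast
qed (auto simp: in_keys_iff)

lemma eval4_add [simp]: "eval4 (P + Q) e = eval4 P e + eval4 Q e"
  unfolding eval4_def by (rule setsum_keys_plus_distrib) (simp_all add: distrib_right)

lemma eval4_0 [simp]: "eval4 0 e = 0"
  by (simp add: eval4_def)

lemma eval4_sum [simp]: "eval4 (sum P I) e = (\<Sum>i\<in>I. eval4 (P i) e)"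
  by (induction I rule: infinite_finite_induct) simp_all

lemma eval4_single [simp]: "eval4 (Poly_Mapping.single m c) e = c * monom_value e m"
  by (cases "c = 0") (simp_all add: eval4_def)

lemma sum_single_lookup:
  "(\<Sum>m\<in>Poly_Mapping.keys P. Poly_Mapping.single m (Poly_Mapping.lookup P m)) = P"
  by (rule poly_mapping_eqI) (simp add: lookup_sum lookup_single when_def in_keys_iff)

lemma eval4_mult [simp]: "eval4 (P * Q) e = eval4 P e * eval4 Q e"
proof -
  let ?term = "\<lambda>R m. Poly_Mapping.single m (Poly_Mapping.lookup R m)"
  have "P * Q = sum (?term P) (Poly_Mapping.keys P) * sum (?term Q) (Poly_Mapping.keys Q)"
    by (simp add: sum_single_lookup)
  also have "\<dots> = (\<Sum>m\<in>Poly_Mapping.keys P. \<Sum>n\<in>Poly_Mapping.keys Q.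
      Poly_Mapping.single (m + n) (Poly_Mapping.lookup P m * Poly_Mapping.lookup Q n))"
    by (simp add: sum_product mult_single)
  finally have "eval4 (P * Q) e = eval4 (\<Sum>m\<in>Poly_Mapping.keys P. \<Sum>n\<in>Poly_Mapping.keys Q.
      Poly_Mapping.single (m + n) (Poly_Mapping.lookup P m * Poly_Mapping.lookup Q n)) e"
    by (rule arg_cong)
  also have "\<dots> = eval4 P e * eval4 Q e"
    by (simp add: monom_value_add eval4_def[of P] eval4_def[of Q] sum_product mult_ac)
  finally show ?thesis .
qed

lemma eval4_1 [simp]: "eval4 1 e = 1"
  using eval4_single[of 0 1 e] by (simp del: eval4_single)

lemma eval4_power [simp]: "eval4 (P ^ n) e = eval4 P e ^ n"
  by (induction n) simp_all

lemma eval4_uminus [simp]: "eval4 (- P) e = - eval4 P e"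
  using eval4_add[of P "- P" e] by (simp add: eq_neg_iff_add_eq_0 add.commute del: eval4_add)

lemma eval4_minus [simp]: "eval4 (P - Q) e = eval4 P e - eval4 Q e"
  using eval4_add[of P "- Q" e] by (simp del: eval4_add)

lemma eval4_Const [simp]: "eval4 (Const c) e = c"
  by (simp add: Const_def)

lemma eval4_Var [simp]: "eval4 (Var v) e = e v"
  by (simp add: Var_def)

lemma eval4_numeral [simp]: "eval4 (numeral n) e = numeral n"
  using eval4_Const[of "numeral n" e] by (simp add: Const_def del: eval4_single eval4_Const)

text \<open>
  Evaluation at a point is defined only for those rational functions that have a representative
  whose denominator does not vanish there.  It is therefore stated as a relation, which is
  functional and compatible with the field operations.
\<close>
definition has_value :: "'k::field poly4 fract \<Rightarrow> (pvar \<Rightarrow> 'k) \<Rightarrow> 'k \<Rightarrow> bool" where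
  "has_value q e c \<longleftrightarrow> (\<exists>N D. q = Fract N D \<and> eval4 D e \<noteq> 0 \<and> c = eval4 N e / eval4 D e)"

lemma has_value_unique:
  assumes "has_value q e c" and "has_value q e c'"
  shows "c = c'"
proof -
  obtain N D N' D' where q: "q = Fract N D" "q = Fract N' D'"
    and D: "eval4 D e \<noteq> 0" "eval4 D' e \<noteq> 0"
    and c: "c = eval4 N e / eval4 D e" "c' = eval4 N' e / eval4 D' e"
    using assms unfolding has_value_def by blast
  have "D \<noteq> 0" "D' \<noteq> 0"
    using D by auto
  with q have "N * D' = N' * D"
    by (simp add: eq_fract)
  then have "eval4 N e * eval4 D' e = eval4 N' e * eval4 D e"
    by (metis eval4_mult)
  with D c show ?thesis
    by (simp add: frac_eq_eq)
qed

lemma has_value_to_fract4: "has_value (to_fract4 F) e (eval4 F e)"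
  unfolding has_value_def to_fract4_def by (rule exI[of _ F], rule exI[of _ 1]) simp

lemma has_value_Const: "has_value (to_fract4 (Const c)) e c"
  using has_value_to_fract4[of "Const c" e] by simp

lemma has_value_Var: "has_value (to_fract4 (Var v)) e (e v)"
  using has_value_to_fract4[of "Var v" e] by simp

lemma has_value_add:
  assumes "has_value p e c" and "has_value q e d"
  shows "has_value (p + q) e (c + d)"
proof -
  obtain N D N' D' where q: "p = Fract N D" "q = Fract N' D'"
    and D: "eval4 D e \<noteq> 0" "eval4 D' e \<noteq> 0"
    and c: "c = eval4 N e / eval4 D e" "d = eval4 N' e / eval4 D' e"
    using assms unfolding has_value_def by blast
  have "D \<noteq> 0" "D' \<noteq> 0"
    using D by auto
  then have "p + q = Fract (N * D' + N' * D) (D * D')"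
    by (simp add: q)
  moreover have "c + d = eval4 (N * D' + N' * D) e / eval4 (D * D') e"
    using D by (simp add: c add_frac_eq)
  ultimately show ?thesis
    unfolding has_value_def using D by (metis eval4_mult mult_eq_0_iff)
qed

lemma has_value_mult:
  assumes "has_value p e c" and "has_value q e d"
  shows "has_value (p * q) e (c * d)"
proof -
  obtain N D N' D' where q: "p = Fract N D" "q = Fract N' D'"
    and D: "eval4 D e \<noteq> 0" "eval4 D' e \<noteq> 0"
    and c: "c = eval4 N e / eval4 D e" "d = eval4 N' e / eval4 D' e"
    using assms unfolding has_value_def by blast
  have "p * q = Fract (N * N') (D * D')"
    by (simp add: q)
  moreover have "c * d = eval4 (N * N') e / eval4 (D * D') e"
    by (simp add: c)
  ultimately show ?thesis
    unfolding has_value_def using D by (metis eval4_mult mult_eq_0_iff)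
qed

lemma has_value_inverse:
  assumes "has_value q e c" and "c \<noteq> 0"
  shows "has_value (inverse q) e (inverse c)"
proof -
  obtain N D where q: "q = Fract N D" "eval4 D e \<noteq> 0" "c = eval4 N e / eval4 D e"
    using assms unfolding has_value_def by blast
  with assms have "eval4 N e \<noteq> 0"
    by auto
  moreover have "inverse q = Fract D N" "inverse c = eval4 D e / eval4 N e"
    by (simp_all add: q)
  ultimately show ?thesis
    unfolding has_value_def by blast
qed

lemma has_value_divide:
  "has_value p e c \<Longrightarrow> has_value q e d \<Longrightarrow> d \<noteq> 0 \<Longrightarrow> has_value (p / q) e (c / d)"
  unfolding divide_inverse by (intro has_value_mult has_value_inverse)

lemma has_value_0: "has_value 0 e 0"
  using has_value_to_fract4[of 0 e] by (simp add: to_fract4_def Zero_fract_def)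

lemma has_value_1: "has_value 1 e 1"
  using has_value_to_fract4[of 1 e] by (simp add: to_fract4_def One_fract_def)

lemma has_value_numeral: "has_value (numeral n) e (numeral n)"
proof -
  have "to_fract4 (numeral n) = (numeral n :: 'a poly4 fract)"
    unfolding to_fract4_def using of_nat_fract[of "numeral n"] by simp
  then show ?thesis
    using has_value_to_fract4[of "numeral n" e] by simp
qed

lemma has_value_uminus: "has_value p e c \<Longrightarrow> has_value (- p) e (- c)"
  using has_value_mult[OF has_value_to_fract4[of "- 1" e], of p c]
  by (simp add: to_fract4_def One_fract_def[symmetric] minus_fract[symmetric] del: minus_fract)

lemma has_value_diff:
  "has_value p e c \<Longrightarrow> has_value q e d \<Longrightarrow> has_value (p - q) e (c - d)"
  using has_value_add[OF _ has_value_uminus] by fastforce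

lemma has_value_power: "has_value p e c \<Longrightarrow> has_value (p ^ n) e (c ^ n)"
  by (induction n) (simp_all add: has_value_1 has_value_mult)

lemma has_value_sum:
  "(\<And>i. i \<in> I \<Longrightarrow> has_value (p i) e (c i)) \<Longrightarrow> has_value (sum p I) e (sum c I)"
  by (induction I rule: infinite_finite_induct) (simp_all add: has_value_0 has_value_add)

lemma has_value_prod:
  "(\<And>i. i \<in> I \<Longrightarrow> has_value (p i) e (c i)) \<Longrightarrow> has_value (prod p I) e (prod c I)"
  by (induction I rule: infinite_finite_induct) (simp_all add: has_value_1 has_value_mult)

lemmas has_value_intros = has_value_0 has_value_1 has_value_numeral has_value_Const has_value_Var
  has_value_add has_value_mult has_value_divide has_value_uminus has_value_diff has_value_power

lemma has_value_subst4:
  assumes "\<And>v. has_value (r v) e (c v)"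
  shows "has_value (subst4 P r) e (eval4 P c)"
  unfolding subst4_def eval4_def monom_value_eq_prod_keys
  by (intro has_value_sum has_value_mult has_value_prod has_value_power has_value_Const assms)

text \<open>
  This turns an identity in the field of rational functions into an identity between values of
  polynomials, valid at every point where the coordinates \<open>r\<close> are defined.
\<close>
lemma polynomial_in_coords_eval4:
  assumes "polynomial_in_coords F r"
  obtains P where "\<And>e c. (\<And>v. has_value (r v) e (c v)) \<Longrightarrow> eval4 F e = eval4 P c"
proof -
  from assms obtain P where "to_fract4 F = subst4 P r"
    unfolding polynomial_in_coords_def by blast
  then have "eval4 F e = eval4 P c" if "\<And>v. has_value (r v) e (c v)" for e c
    using has_value_unique[OF has_value_to_fract4, of F e] has_value_subst4[of r e c P] that by simp
  with that show thesis by blast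
qed

lemma coords_simps [simp]:
  "coords a b c d VX = a" "coords a b c d VY = b" "coords a b c d VZ = c" "coords a b c d VW = d"
  by (simp_all add: coords_def)

lemma has_value_coords:
  assumes "has_value X e x" "has_value Y e y" "has_value Z e z" "has_value W e w"
  shows "has_value (coords X Y Z W v) e (coords x y z w v)"
  using assms by (cases v) simp_all

section \<open>The four charts as substitutions\<close>

text \<open>
  Each change of coordinates is birational.  Reading it backwards expresses \<open>K\<close>, after the inverse
  substitution, as a polynomial in the new coordinates: the substitution has a denominator, the
  result has none.  The charts \<open>r1\<close> and \<open>r3\<close> are involutions, so for them the inverse substitution
  has the same shape as the chart.
\<close>
lemma chart_r0:
  assumes "polynomial_in_coords K (r0 \<alpha>)"
  obtains P where "\<And>x y z w. y \<noteq> 0 \<Longrightarrow>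
    eval4 K (coords (x - cst \<alpha> / y - 1 / y ^ 2) y z w) = eval4 P (coords x y z w)"
proof -
  obtain P where P: "\<And>e c. (\<And>v. has_value (r0 \<alpha> v) e (c v)) \<Longrightarrow> eval4 K e = eval4 P c"
    using polynomial_in_coords_eval4[OF assms] by blast
  show thesis
  proof (rule that, rule P)
    fix x y z w :: ratt and v
    assume y: "y \<noteq> 0"
    let ?e = "coords (x - cst \<alpha> / y - 1 / y ^ 2) y z w"
    have "has_value (r0 \<alpha> v) ?e
        (coords (?e VX + cst \<alpha> / ?e VY + 1 / ?e VY ^ 2) (?e VY) (?e VZ) (?e VW) v)"
      unfolding r0_def Let_def by (intro has_value_coords has_value_intros) (use y in simp_all)
    then show "has_value (r0 \<alpha> v) ?e (coords x y z w v)"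
      by simp
  qed
qed

lemma chart_r1:
  assumes "polynomial_in_coords K (r1 \<alpha>)"
  obtains P where "\<And>x y z w. y \<noteq> 0 \<Longrightarrow>
    eval4 K (coords ((cst \<alpha> - x * y) * y) (1 / y) z w) = eval4 P (coords x y z w)"
proof -
  obtain P where P: "\<And>e c. (\<And>v. has_value (r1 \<alpha> v) e (c v)) \<Longrightarrow> eval4 K e = eval4 P c"
    using polynomial_in_coords_eval4[OF assms] by blast
  show thesis
  proof (rule that, rule P)
    fix x y z w :: ratt and v
    assume y: "y \<noteq> 0"
    let ?e = "coords ((cst \<alpha> - x * y) * y) (1 / y) z w"
    have "has_value (r1 \<alpha> v) ?e
        (coords (- (?e VX * ?e VY - cst \<alpha>) * ?e VY) (1 / ?e VY) (?e VZ) (?e VW) v)"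
      unfolding r1_def Let_def by (intro has_value_coords has_value_intros) (use y in simp_all)
    then show "has_value (r1 \<alpha> v) ?e (coords x y z w v)"
      using y by simp
  qed
qed

lemma chart_r2:
  assumes "polynomial_in_coords K (r2 \<alpha>)"
  obtains P where "\<And>x y z w. x \<noteq> 0 \<Longrightarrow>
    eval4 K (coords (1 / x) (tvar - w ^ 2 - cst \<alpha> * x - y * x ^ 2) (z + 2 * w / x) w)
      = eval4 P (coords x y z w)"
proof -
  obtain P where P: "\<And>e c. (\<And>v. has_value (r2 \<alpha> v) e (c v)) \<Longrightarrow> eval4 K e = eval4 P c"
    using polynomial_in_coords_eval4[OF assms] by blast
  show thesis
  proof (rule that, rule P)
    fix x y z w :: ratt and v
    assume x: "x \<noteq> 0"
    let ?e = "coords (1 / x) (tvar - w ^ 2 - cst \<alpha> * x - y * x ^ 2) (z + 2 * w / x) w"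
    have "has_value (r2 \<alpha> v) ?e
        (coords (1 / ?e VX) (- ((?e VY + ?e VW ^ 2 - tvar) * ?e VX + cst \<alpha>) * ?e VX)
          (?e VZ - 2 * ?e VX * ?e VW) (?e VW) v)"
      unfolding r2_def Let_def by (intro has_value_coords has_value_intros) (use x in simp_all)
    moreover have "- ((?e VY + ?e VW ^ 2 - tvar) * ?e VX + cst \<alpha>) * ?e VX = y"
      using x by (simp add: field_simps power2_eq_square)
    ultimately show "has_value (r2 \<alpha> v) ?e (coords x y z w v)"
      by simp
  qed
qed

lemma chart_r3:
  assumes "polynomial_in_coords K (r3 \<alpha>)"
  obtains P where "\<And>x y z w. w \<noteq> 0 \<Longrightarrow>
    eval4 K (coords x y ((cst \<alpha> - z * w) * w) (1 / w)) = eval4 P (coords x y z w)"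
proof -
  obtain P where P: "\<And>e c. (\<And>v. has_value (r3 \<alpha> v) e (c v)) \<Longrightarrow> eval4 K e = eval4 P c"
    using polynomial_in_coords_eval4[OF assms] by blast
  show thesis
  proof (rule that, rule P)
    fix x y z w :: ratt and v
    assume w: "w \<noteq> 0"
    let ?e = "coords x y ((cst \<alpha> - z * w) * w) (1 / w)"
    have "has_value (r3 \<alpha> v) ?e
        (coords (?e VX) (?e VY) (- (?e VZ * ?e VW - cst \<alpha>) * ?e VW) (1 / ?e VW) v)"
      unfolding r3_def Let_def by (intro has_value_coords has_value_intros) (use w in simp_all)
    then show "has_value (r3 \<alpha> v) ?e (coords x y z w v)"
      using w by simp
  qed
qed

section \<open>Coefficients of polynomials in four variables\<close>

definition coeff4 :: "'a::zero poly4 \<Rightarrow> nat \<Rightarrow> nat \<Rightarrow> nat \<Rightarrow> nat \<Rightarrow> 'a" where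
  "coeff4 P a b c d = Poly_Mapping.lookup P (Poly_Mapping.single VX a + Poly_Mapping.single VY b
     + Poly_Mapping.single VZ c + Poly_Mapping.single VW d)"

lemma exponents_eq:
  fixes m :: "pvar \<Rightarrow>\<^sub>0 nat"
  shows "Poly_Mapping.single VX (Poly_Mapping.lookup m VX)
    + Poly_Mapping.single VY (Poly_Mapping.lookup m VY)
    + Poly_Mapping.single VZ (Poly_Mapping.lookup m VZ)
    + Poly_Mapping.single VW (Poly_Mapping.lookup m VW) = m"
proof (rule poly_mapping_eqI)
  fix v show "Poly_Mapping.lookup (Poly_Mapping.single VX (Poly_Mapping.lookup m VX)
    + Poly_Mapping.single VY (Poly_Mapping.lookup m VY)
    + Poly_Mapping.single VZ (Poly_Mapping.lookup m VZ)
    + Poly_Mapping.single VW (Poly_Mapping.lookup m VW)) v = Poly_Mapping.lookup m v"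
    by (cases v) (simp_all add: lookup_add lookup_single)
qed

lemma lookup_eq_coeff4:
  "Poly_Mapping.lookup P m = coeff4 P (Poly_Mapping.lookup m VX) (Poly_Mapping.lookup m VY)
     (Poly_Mapping.lookup m VZ) (Poly_Mapping.lookup m VW)"
  unfolding coeff4_def exponents_eq ..

lemma coeff4_eq_0:
  assumes "total_degree P < a + b + c + d"
  shows "coeff4 P a b c d = 0"
proof (rule ccontr)
  let ?m = "Poly_Mapping.single VX a + Poly_Mapping.single VY b
     + Poly_Mapping.single VZ c + Poly_Mapping.single VW d"
  let ?deg = "\<lambda>m. \<Sum>v\<in>Poly_Mapping.keys m. Poly_Mapping.lookup m v"
  assume "coeff4 P a b c d \<noteq> 0"
  then have "?m \<in> Poly_Mapping.keys P"
    by (simp add: coeff4_def in_keys_iff)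
  then have "?deg ?m \<le> total_degree P"
    unfolding total_degree_def by (intro Max_ge) auto
  moreover have "?deg ?m = (\<Sum>v\<in>{VX, VY, VZ, VW}. Poly_Mapping.lookup ?m v)"
    by (rule sum.mono_neutral_left) (use pvar.exhaust in \<open>auto simp: in_keys_iff\<close>)
  then have "?deg ?m = a + b + c + d"
    by (simp add: lookup_add lookup_single)
  ultimately show False
    using assms by simp
qed

text \<open>
  The coefficients are grouped as polynomials in \<open>z\<close>, \<open>w\<close> because the charts \<open>r0\<close> and \<open>r1\<close> leave
  \<open>z\<close> and \<open>w\<close> fixed.
\<close>
lemma eval4_coords:
  assumes "total_degree P \<le> N"
  shows "eval4 P (coords x y z w) =
    (\<Sum>a\<le>N. \<Sum>b\<le>N. (\<Sum>c\<le>N. \<Sum>d\<le>N. coeff4 P a b c d * z ^ c * w ^ d) * x ^ a * y ^ b)"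
proof -
  let ?e = "coords x y z w"
  define expo where "expo = (\<lambda>(a, b, c, d). Poly_Mapping.single VX a + Poly_Mapping.single VY b
     + Poly_Mapping.single VZ c + Poly_Mapping.single VW (d :: nat))"
  have inj: "inj expo"
  proof (rule injI)
    fix p q
    assume "expo p = expo q"
    then have "Poly_Mapping.lookup (expo p) v = Poly_Mapping.lookup (expo q) v" for v
      by simp
    from this[of VX] this[of VY] this[of VZ] this[of VW]
    show "p = q"
      by (cases p; cases q) (simp add: expo_def lookup_add lookup_single)
  qed
  have keys: "Poly_Mapping.keys P \<subseteq> expo ` ({..N} \<times> {..N} \<times> {..N} \<times> {..N})"
  proof
    fix m assume m: "m \<in> Poly_Mapping.keys P"
    let ?q = "(Poly_Mapping.lookup m VX, Poly_Mapping.lookup m VY, Poly_Mapping.lookup m VZ,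
      Poly_Mapping.lookup m VW)"
    have "coeff4 P (Poly_Mapping.lookup m VX) (Poly_Mapping.lookup m VY)
        (Poly_Mapping.lookup m VZ) (Poly_Mapping.lookup m VW) \<noteq> 0"
      using m by (simp add: lookup_eq_coeff4[symmetric] in_keys_iff)
    then have "Poly_Mapping.lookup m VX + Poly_Mapping.lookup m VY + Poly_Mapping.lookup m VZ
        + Poly_Mapping.lookup m VW \<le> N"
      using coeff4_eq_0 assms by (meson le_trans not_le)
    then have "?q \<in> {..N} \<times> {..N} \<times> {..N} \<times> {..N}"
      by simp
    moreover have "m = expo ?q"
      by (simp add: expo_def exponents_eq)
    ultimately show "m \<in> expo ` ({..N} \<times> {..N} \<times> {..N} \<times> {..N})"
      by blast
  qed
  have "eval4 P ?e = (\<Sum>m\<in>expo ` ({..N} \<times> {..N} \<times> {..N} \<times> {..N}).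
      Poly_Mapping.lookup P m * monom_value ?e m)"
    unfolding eval4_def by (rule sum.mono_neutral_left) (use keys in \<open>auto simp: in_keys_iff\<close>)
  also have "\<dots> = (\<Sum>q\<in>{..N} \<times> {..N} \<times> {..N} \<times> {..N}.
      Poly_Mapping.lookup P (expo q) * monom_value ?e (expo q))"
    using inj by (subst sum.reindex) (auto intro: inj_on_subset)
  also have "\<dots> = (\<Sum>a\<le>N. \<Sum>b\<le>N. \<Sum>c\<le>N. \<Sum>d\<le>N.
      coeff4 P a b c d * (x ^ a * y ^ b * z ^ c * w ^ d))"
    by (simp add: sum.cartesian_product' expo_def coeff4_def monom_value_add case_prod_beta)
  finally show ?thesis
    by (simp add: sum_distrib_right sum_distrib_left mult_ac)
qed

section \<open>Comparing coefficients away from zero\<close>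

lemma poly_eqI_off_zero:
  fixes p q :: "'k::field_char_0 poly"
  assumes "\<And>y. y \<noteq> 0 \<Longrightarrow> poly p y = poly q y"
  shows "p = q"
proof -
  have "poly ([:0, 1:] * (p - q)) y = 0" for y
    using assms[of y] by (cases "y = 0") simp_all
  then have "[:0, 1:] * (p - q) = 0"
    using poly_all_0_iff_0 by blast
  then show ?thesis
    by simp
qed

text \<open>
  Stated for a sum over an arbitrary index set, since the expansions below produce the same power
  of \<open>y\<close> from many terms.
\<close>
lemma coeffs_below_eq_0:
  fixes f :: "'i \<Rightarrow> 'k::field_char_0"
  assumes "\<And>y. y \<noteq> 0 \<Longrightarrow> (\<Sum>\<tau>\<in>T. f \<tau> * y ^ e \<tau>) = y ^ M * poly p y" and "m < M"
  shows "(\<Sum>\<tau>\<in>T. if e \<tau> = m then f \<tau> else 0) = 0"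
proof -
  have "(\<Sum>\<tau>\<in>T. monom (f \<tau>) (e \<tau>)) = monom 1 M * p"
    by (rule poly_eqI_off_zero) (simp add: poly_sum poly_monom assms(1))
  then have "coeff (\<Sum>\<tau>\<in>T. monom (f \<tau>) (e \<tau>)) m = coeff (monom 1 M * p) m"
    by simp
  then show ?thesis
    using \<open>m < M\<close> by (simp add: coeff_sum coeff_monom_mult)
qed

lemma coeff_linear_poly_power_all:
  fixes u v :: "'k::comm_semiring_1"
  shows "coeff ([:u, v:] ^ a) i = of_nat (a choose i) * v ^ i * u ^ (a - i)"
proof (cases "i \<le> a")
  case False
  have "degree ([:u, v:] ^ a) \<le> a"
    using degree_power_le[of "[:u, v:]" a] by (cases "v = 0") simp_all
  with False show ?thesis
    by (simp add: coeff_eq_0 binomial_eq_0)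
qed (rule coeff_linear_poly_power)

lemma taylor_coeff:
  fixes u v :: "'k::field_char_0"
  assumes "\<And>x. (\<Sum>a\<le>M. h a * (u + v * x) ^ a) = (\<Sum>i\<le>N. q i * x ^ i)"
  shows "(\<Sum>a\<le>M. h a * (of_nat (a choose i) * v ^ i * u ^ (a - i))) = (if i \<le> N then q i else 0)"
proof -
  have "poly (\<Sum>a\<le>M. smult (h a) ([:u, v:] ^ a)) x = poly (\<Sum>i\<le>N. monom (q i) i) x" for x
    using assms[of x] by (simp add: poly_sum poly_monom mult.commute)
  then have "(\<Sum>a\<le>M. smult (h a) ([:u, v:] ^ a)) = (\<Sum>i\<le>N. monom (q i) i)"
    by (simp add: poly_eq_poly_eq_iff[symmetric] fun_eq_iff)
  then have "coeff (\<Sum>a\<le>M. smult (h a) ([:u, v:] ^ a)) i = coeff (\<Sum>i\<le>N. monom (q i) i) i"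
    by simp
  then show ?thesis
    by (simp add: coeff_sum coeff_linear_poly_power_all)
qed

lemma sum_atMost_6:
  fixes f :: "nat \<Rightarrow> 'a::comm_monoid_add"
  shows "(\<Sum>a\<le>6. f a) = f 0 + f 1 + f 2 + f 3 + f 4 + f 5 + f 6"
  by (simp add: eval_nat_numeral)

lemma sum_powers_eqD:
  fixes f h :: "nat \<Rightarrow> 'k::field_char_0"
  assumes "\<And>x. (\<Sum>a\<le>M. f a * x ^ a) = (\<Sum>a\<le>N. h a * x ^ a)" and "a \<le> M" and "M \<le> N"
  shows "f a = h a"
proof -
  have "(\<Sum>a\<le>M. monom (f a) a) = (\<Sum>a\<le>N. monom (h a) a)"
    by (rule poly_eqI_off_zero) (simp add: poly_sum poly_monom assms(1))
  then have "coeff (\<Sum>a\<le>M. monom (f a) a) a = coeff (\<Sum>a\<le>N. monom (h a) a) a"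
    by simp
  then show ?thesis
    using assms(2,3) by (simp add: coeff_sum)
qed

lemma sum_powers2_eqD:
  fixes f h :: "nat \<Rightarrow> nat \<Rightarrow> 'k::field_char_0"
  assumes "\<And>x y. (\<Sum>a\<le>M. \<Sum>b\<le>M. f a b * x ^ a * y ^ b) = (\<Sum>a\<le>N. \<Sum>b\<le>N. h a b * x ^ a * y ^ b)"
    and "a \<le> M" and "b \<le> M" and "M \<le> N"
  shows "f a b = h a b"
proof -
  have "(\<Sum>b\<le>M. f a b * y ^ b) = (\<Sum>b\<le>N. h a b * y ^ b)" for y
  proof (rule sum_powers_eqD[OF _ \<open>a \<le> M\<close> \<open>M \<le> N\<close>])
    fix x
    show "(\<Sum>a\<le>M. (\<Sum>b\<le>M. f a b * y ^ b) * x ^ a) = (\<Sum>a\<le>N. (\<Sum>b\<le>N. h a b * y ^ b) * x ^ a)"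
      using assms(1)[of x y] by (simp add: sum_distrib_left sum_distrib_right mult_ac)
  qed
  then show ?thesis
    using assms(3,4) by (rule sum_powers_eqD)
qed

section \<open>The relations imposed by the charts that act on two variables\<close>

text \<open>
  In the inverted chart \<open>((\<alpha> - x y) y, 1/y)\<close> the monomial \<open>x^a y^b\<close> becomes
  \<open>(\<alpha> - x y)^a y^(a - b)\<close>.  It contributes to the coefficient of \<open>x^i y^(-n)\<close> exactly if
  \<open>b = a + i + n\<close>, so there is one linear relation for each \<open>i\<close> and each \<open>n \<ge> 1\<close>.  With
  \<open>m = i + n\<close> fixed, these relations together say that \<open>(u - \<alpha>)^m\<close> divides the polynomial
  in \<open>u\<close> with coefficients \<open>g a (a + m)\<close>.
\<close>
lemma inversion_coeff:
  fixes g :: "nat \<Rightarrow> nat \<Rightarrow> 'k::field_char_0"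
  assumes pol: "\<And>x y. y \<noteq> 0 \<Longrightarrow>
      (\<Sum>a\<le>6. \<Sum>b\<le>6. g a b * ((\<alpha> - x * y) * y) ^ a * (1 / y) ^ b)
        = (\<Sum>i\<le>N. \<Sum>j\<le>N. p i j * x ^ i * y ^ j)"
    and n: "1 \<le> n"
  shows "(\<Sum>a\<le>6. if a + i + n \<le> 6 then of_nat (a choose i) * \<alpha> ^ (a - i) * g a (a + i + n)
      else 0) = 0"
proof (cases "n \<le> 6")
  case True
  let ?q = "if i \<le> N then \<Sum>j\<le>N. monom (p i j) j else 0"
  let ?f = "\<lambda>(a, b). (- 1) ^ i * (of_nat (a choose i) * \<alpha> ^ (a - i) * g a b)"
  have main: "(\<Sum>\<tau>\<in>{..6} \<times> {..6}. ?f \<tau> * y ^ (case \<tau> of (a, b) \<Rightarrow> a + i + (6 - b)))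
      = y ^ 6 * poly ?q y"
    if y: "y \<noteq> 0" for y
  proof -
    have "(\<Sum>a\<le>6. (\<Sum>b\<le>6. g a b / y ^ b) * (\<alpha> * y + - (y ^ 2) * x) ^ a)
        = (\<Sum>i\<le>N. (\<Sum>j\<le>N. p i j * y ^ j) * x ^ i)" for x
      using pol[OF y, of x]
      by (simp add: sum_distrib_right sum_distrib_left power_one_over field_simps power2_eq_square)
    from taylor_coeff[OF this, of i]
    have "y ^ 6 * (\<Sum>a\<le>6. (\<Sum>b\<le>6. g a b / y ^ b)
        * (of_nat (a choose i) * (- (y ^ 2)) ^ i * (\<alpha> * y) ^ (a - i)))
        = y ^ 6 * poly ?q y"
      by (simp add: poly_sum poly_monom)
    moreover have "y ^ 6 * (g a b / y ^ b * (of_nat (a choose i) * (- (y ^ 2)) ^ i * (\<alpha> * y) ^ (a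
        - i)))
        = ?f (a, b) * y ^ (a + i + (6 - b))" if "b \<le> 6" for a b
    proof (cases "i \<le> a")
      case True
      have "y ^ 6 = y ^ b * y ^ (6 - b)"
        using that by (simp flip: power_add)
      moreover have "(- (y ^ 2)) ^ i * y ^ (a - i) = (- 1) ^ i * y ^ (a + i)"
        using True by (subst power_minus) (simp add: power_mult[symmetric] power_add[symmetric]
            mult.assoc add.commute)
      ultimately show ?thesis
        using y by (simp add: power_mult_distrib power_add mult_ac)
    qed (simp add: binomial_eq_0)
    ultimately show ?thesis
      by (simp add: sum.cartesian_product' sum_distrib_left sum_distrib_right mult.assoc)
  qed
  \<comment> \<open>After multiplication by \<open>y^6\<close>, the pole of order \<open>n\<close> sits at the exponent \<open>6 - n\<close>.\<close>
  have "(\<Sum>\<tau>\<in>{..6} \<times> {..6}. if (case \<tau> of (a, b) \<Rightarrow> a + i + (6 - b)) = 6 - n then ?f \<tau> else 0) = 0"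
    by (rule coeffs_below_eq_0[OF main]) (use n True in auto)
  moreover have "(\<Sum>b\<le>6. if a + i + (6 - b) = 6 - n then ?f (a, b) else 0)
      = (- 1) ^ i * (if a + i + n \<le> 6 then of_nat (a choose i) * \<alpha> ^ (a - i) * g a (a + i + n)
          else 0)" for a
  proof -
    have "(\<Sum>b\<le>6. if a + i + (6 - b) = 6 - n then ?f (a, b) else 0)
       = (\<Sum>b\<le>6. if b = a + i + n then ?f (a, b) else 0)"
      by (rule sum.cong[OF refl], rule if_cong) (use True n in \<open>simp_all, arith\<close>)
    then show ?thesis by simp
  qed
  ultimately have "(- 1) ^ i * (\<Sum>a\<le>6. if a + i
      + n \<le> 6 then of_nat (a choose i) * \<alpha> ^ (a - i) * g a (a + i + n) else 0) = 0"
    by (simp add: sum.cartesian_product' sum_distrib_left)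
  then show ?thesis by simp
qed (auto intro!: sum.neutral)

text \<open>
  Here \<open>x\<close> is replaced by \<open>x - (\<alpha> y + 1) / y^2\<close>.  The contribution of \<open>x^a y^b\<close> to the coefficient
  of \<open>x^i\<close> is a multiple of \<open>(\<alpha> y + 1)^(a - i) y^(b - 2 (a - i))\<close>, and the power of
  \<open>\<alpha> y + 1\<close> is expanded with the summation index \<open>k\<close>.  The bound 12 on the pole order comes from
  \<open>a \<le> 6\<close>.
\<close>
lemma shift_coeff:
  fixes g :: "nat \<Rightarrow> nat \<Rightarrow> 'k::field_char_0"
  assumes pol: "\<And>x y. y \<noteq> 0 \<Longrightarrow>
      (\<Sum>a\<le>6. \<Sum>b\<le>6. g a b * (x - \<alpha> / y - 1 / y ^ 2) ^ a * y ^ b)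
        = (\<Sum>i\<le>N. \<Sum>j\<le>N. p i j * x ^ i * y ^ j)"
    and deg: "\<And>a b. a + b > 6 \<Longrightarrow> g a b = 0"
    and n: "1 \<le> n" "n \<le> 12"
  shows "(\<Sum>a\<le>6. \<Sum>k\<le>6. if k + n \<le> 2 * (a - i)
    then (- 1) ^ (a - i) * of_nat (a choose i) * of_nat ((a - i) choose k) * \<alpha> ^ k
        * g a (2 * (a - i) - k - n) else 0) = 0"
proof -
  let ?q = "if i \<le> N then \<Sum>j\<le>N. monom (p i j) j else 0"
  let ?f = "\<lambda>(a, k, b). (- 1) ^ (a - i) * of_nat (a choose i) * of_nat ((a - i) choose k) * \<alpha> ^ k
      * g a b"
  let ?e = "\<lambda>(a, k, b). b + k + (12 - 2 * (a - i))"
  have main: "(\<Sum>\<tau>\<in>{..6} \<times> {..6} \<times> {..6}. ?f \<tau> * y ^ ?e \<tau>) = y ^ 12 * poly ?q y"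
    if y: "y \<noteq> 0" for y
  proof -
    have "x - \<alpha> / y - 1 / y ^ 2 = - ((\<alpha> * y + 1) / y ^ 2) + 1 * x" for x
      using y by (simp add: field_simps power2_eq_square)
    note x_eq = this
    have "(\<Sum>a\<le>6. (\<Sum>b\<le>6. g a b * y ^ b) * (- ((\<alpha> * y + 1) / y ^ 2) + 1 * x) ^ a)
        = (\<Sum>i\<le>N. (\<Sum>j\<le>N. p i j * y ^ j) * x ^ i)" for x
      using pol[OF y, of x] unfolding x_eq by (simp add: sum_distrib_right sum_distrib_left mult_ac)
    from taylor_coeff[OF this, of i]
    have "y ^ 12 * (\<Sum>a\<le>6. (\<Sum>b\<le>6. g a b * y ^ b) * (of_nat (a choose i) * (- ((\<alpha> * y
        + 1) / y ^ 2)) ^ (a - i)))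
        = y ^ 12 * poly ?q y"
      by (simp add: poly_sum poly_monom)
    moreover have "y ^ 12 * ((\<Sum>b\<le>6. g a b * y ^ b) * (of_nat (a choose i) * (- ((\<alpha> * y
        + 1) / y ^ 2)) ^ (a - i)))
        = (\<Sum>k\<le>6. \<Sum>b\<le>6. ?f (a, k, b) * y ^ ?e (a, k, b))" if a: "a \<le> 6" for a
    proof -
      have "(\<alpha> * y + 1) ^ (a - i) = (\<Sum>k\<le>a - i. of_nat ((a - i) choose k) * \<alpha> ^ k * y ^ k)"
        by (simp add: binomial_ring power_mult_distrib mult_ac)
      also have "\<dots> = (\<Sum>k\<le>6. of_nat ((a - i) choose k) * \<alpha> ^ k * y ^ k)"
        by (rule sum.mono_neutral_left) (use a in auto)
      finally have bin: "(\<alpha> * y + 1) ^ (a - i)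
          = (\<Sum>k\<le>6. of_nat ((a - i) choose k) * \<alpha> ^ k * y ^ k)" .
      have "(y ^ 12 :: 'k) = y ^ (2 * (a - i)) * y ^ (12 - 2 * (a - i))"
        using a by (simp flip: power_add)
      then have "y ^ 12 * (- ((\<alpha> * y + 1) / y ^ 2)) ^ (a - i)
          = (- 1) ^ (a - i) * (\<Sum>k\<le>6. of_nat ((a - i) choose k) * \<alpha> ^ k * y ^ k) * y ^ (12
              - 2 * (a - i))"
        using y by (subst power_minus) (simp add: power_divide power_mult[symmetric] bin)
      note Z = this
      have "y ^ 12 * ((\<Sum>b\<le>6. g a b * y ^ b) * (of_nat (a choose i) * (- ((\<alpha> * y
          + 1) / y ^ 2)) ^ (a - i)))
        = (\<Sum>b\<le>6. g a b * y ^ b) * of_nat (a choose i)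
            * (y ^ 12 * (- ((\<alpha> * y + 1) / y ^ 2)) ^ (a - i))"
        by (simp only: mult_ac)
      also have "\<dots> = (\<Sum>b\<le>6. g a b * y ^ b) * of_nat (a choose i) *
          ((- 1) ^ (a - i) * (\<Sum>k\<le>6. of_nat ((a - i) choose k) * \<alpha> ^ k * y ^ k) * y ^ (12
              - 2 * (a - i)))"
        by (simp only: Z)
      also have "\<dots> = (\<Sum>k\<le>6. \<Sum>b\<le>6. ?f (a, k, b) * y ^ ?e (a, k, b))"
        by (simp add: sum_distrib_left sum_distrib_right power_add mult_ac)
      finally show ?thesis .
    qed
    ultimately show ?thesis
      by (simp add: sum.cartesian_product' sum_distrib_left)
  qed
  have exponent: "b + k + (12 - m) = 12 - n \<longleftrightarrow> k + n \<le> m \<and> b = m - k - n" if "m \<le> 12" for b k m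
    using that n by arith
  have inner: "(\<Sum>b\<le>6. if b + k + (12 - 2 * (a - i)) = 12 - n then c * g a b else 0)
      = (if k + n \<le> 2 * (a - i) then c * g a (2 * (a - i) - k - n) else 0)" if "a \<le> 6" for a k c
  proof -
    have "2 * (a - i) \<le> 12"
      using that by simp
    note exponent[OF this]
    moreover have "c * g a (2 * (a - i) - k - n) = 0" if "6 < 2 * (a - i) - k - n"
      using deg that by simp
    ultimately show ?thesis
      by simp
  qed
  have "(\<Sum>\<tau>\<in>{..6} \<times> {..6} \<times> {..6}. if ?e \<tau> = 12 - n then ?f \<tau> else 0) = 0"
    by (rule coeffs_below_eq_0[OF main]) (use n in auto)
  then have "(\<Sum>a\<le>6. \<Sum>k\<le>6. \<Sum>b\<le>6. if b + k + (12 - 2 * (a - i)) = 12 - n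
      then (- 1) ^ (a - i) * of_nat (a choose i) * of_nat ((a - i) choose k) * \<alpha> ^ k * g a b
          else 0) = 0"
    by (simp add: sum.cartesian_product' cong: if_cong)
  also have "(\<Sum>a\<le>6. \<Sum>k\<le>6. \<Sum>b\<le>6. if b + k + (12 - 2 * (a - i)) = 12 - n
      then (- 1) ^ (a - i) * of_nat (a choose i) * of_nat ((a - i) choose k) * \<alpha> ^ k * g a b else 0)
    = (\<Sum>a\<le>6. \<Sum>k\<le>6. if k + n \<le> 2 * (a - i)
    then (- 1) ^ (a - i) * of_nat (a choose i) * of_nat ((a - i) choose k) * \<alpha> ^ k
        * g a (2 * (a - i) - k - n) else 0)"
    by (intro sum.cong refl inner) simp
  finally show ?thesis .
qed

text \<open>
  A polynomial of degree less than \<open>m\<close> that is divisible by \<open>(u - \<alpha>)^m\<close> vanishes.  As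
  \<open>2 a + m \<le> 6\<close>, this is the case for \<open>m \<ge> 3\<close>.  For \<open>m = 1\<close> a root at \<open>\<alpha>\<close> remains as the condition,
  and for \<open>m = 2\<close> a double root.
\<close>
lemma inversion_relations:
  fixes g :: "nat \<Rightarrow> nat \<Rightarrow> 'k::field_char_0"
  assumes pol: "\<And>x y. y \<noteq> 0 \<Longrightarrow>
      (\<Sum>a\<le>6. \<Sum>b\<le>6. g a b * ((\<alpha> - x * y) * y) ^ a * (1 / y) ^ b)
        = (\<Sum>i\<le>N. \<Sum>j\<le>N. p i j * x ^ i * y ^ j)"
    and deg: "\<And>a b. a + b > 6 \<Longrightarrow> g a b = 0"
  shows "g 0 3 = 0" "g 1 4 = 0" "g 0 4 = 0" "g 1 5 = 0" "g 0 5 = 0" "g 0 6 = 0"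
    and "g 0 1 = - \<alpha> * g 1 2 - \<alpha> ^ 2 * g 2 3" "g 0 2 = \<alpha> ^ 2 * g 2 4" "g 1 3 = - 2 * \<alpha> * g 2 4"
proof -
  note c = inversion_coeff[OF pol]
  note simps = sum_atMost_6 deg eval_nat_numeral
  have m1: "g 0 1 + \<alpha> * g 1 2 + \<alpha> ^ 2 * g 2 3 = 0"
    using c[where i=0 and n=1] by (simp add: simps algebra_simps)
  have m2: "g 0 2 + \<alpha> * g 1 3 + \<alpha> ^ 2 * g 2 4 = 0" "g 1 3 + 2 * \<alpha> * g 2 4 = 0"
    using c[where i=0 and n=2] c[where i=1 and n=1] by (simp_all add: simps algebra_simps)
  have m3: "g 0 3 + \<alpha> * g 1 4 = 0" "g 1 4 = 0"
    using c[where i=0 and n=3] c[where i=1 and n=2] by (simp_all add: simps algebra_simps)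
  have m4: "g 0 4 + \<alpha> * g 1 5 = 0" "g 1 5 = 0"
    using c[where i=0 and n=4] c[where i=1 and n=3] by (simp_all add: simps algebra_simps)
  have m5: "g 0 5 = 0" "g 0 6 = 0"
    using c[where i=0 and n=5] c[where i=0 and n=6] by (simp_all add: simps)
  show "g 0 3 = 0" "g 1 4 = 0" "g 0 4 = 0" "g 1 5 = 0" "g 0 5 = 0" "g 0 6 = 0"
    using m3 m4 m5 by simp_all
  show "g 0 1 = - \<alpha> * g 1 2 - \<alpha> ^ 2 * g 2 3" "g 1 3 = - 2 * \<alpha> * g 2 4"
    using m1 m2(2) by (simp_all add: algebra_simps eq_neg_iff_add_eq_0)
  then show "g 0 2 = \<alpha> ^ 2 * g 2 4"
    using m2(1) by (simp add: algebra_simps power2_eq_square)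
qed

text \<open>
  The weight of \<open>x^a y^b\<close> is \<open>2 a - b\<close>, its pole order in \<open>y\<close>. At the highest weight \<open>n\<close> that
  occurs, absence of poles forces divisibility by \<open>(u + 1)^l\<close> and, since \<open>a \<ge> n / 2\<close>, also by
  \<open>u^l\<close>, where \<open>l = \<lceil>n / 2\<rceil>\<close>; but the degree \<open>a\<close> is at most \<open>(n + 6) / 3\<close>. So nothing of weight 3
  or more survives, and in the weights 2 and 1 one relation each remains. The proof carries this
  out on single coefficients, from high powers of \<open>x\<close> to low ones.
\<close>
lemma shift_relations:
  fixes g :: "nat \<Rightarrow> nat \<Rightarrow> 'k::field_char_0"
  assumes pol: "\<And>x y. y \<noteq> 0 \<Longrightarrow>
      (\<Sum>a\<le>6. \<Sum>b\<le>6. g a b * (x - \<alpha> / y - 1 / y ^ 2) ^ a * y ^ b)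
        = (\<Sum>i\<le>N. \<Sum>j\<le>N. p i j * x ^ i * y ^ j)"
    and deg: "\<And>a b. a + b > 6 \<Longrightarrow> g a b = 0"
  shows "g 2 0 = 0" "g 2 1 = 0" "g 3 0 = 0" "g 3 1 = 0" "g 3 2 = 0" "g 3 3 = 0"
    "g 4 0 = 0" "g 4 1 = 0" "g 4 2 = 0" "g 5 0 = 0" "g 5 1 = 0" "g 6 0 = 0"
    and "g 1 0 = g 2 2" "g 1 1 = g 2 3 + \<alpha> * g 2 2"
proof -
  note c = shift_coeff[OF pol deg]
  \<comment> \<open>For the simplifier, which leaves binomial coefficients of numerals unevaluated.\<close>
  have choose: "(3::nat) choose 2 = 3" "(4::nat) choose 2 = 6" "(4::nat) choose 3 = 4"
    "(5::nat) choose 2 = 10" "(5::nat) choose 3 = 10" "(5::nat) choose 4 = 5"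
    "(6::nat) choose 2 = 15" "(6::nat) choose 3 = 20" "(6::nat) choose 4
        = 15" "(6::nat) choose 5 = 6"
    by (simp_all add: eval_nat_numeral)
  note simps = sum_atMost_6 deg numeral_2_eq_2[symmetric] choose algebra_simps
  have 60: "g 6 0 = 0"
    using c[where i=5 and n=2] by (simp add: simps)
  have 50: "g 5 0 = 0"
    using c[where i=4 and n=2] 60 by (simp add: simps)
  have 51: "g 5 1 = 0"
    using c[where i=4 and n=1] 60 50 by (simp add: simps)
  have 40: "g 4 0 = 0"
    using c[where i=3 and n=2] 60 50 51 by (simp add: simps)
  have 41: "g 4 1 = 0"
    using c[where i=3 and n=1] 60 50 51 40 by (simp add: simps)
  note z = 60 50 51 40 41
  have e1: "2 * g 4 2 = g 3 0"
    using c[where i=2 and n=2] z by (simp add: simps)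
  have e2: "3 * g 3 0 = 4 * g 4 2"
    using c[where i=1 and n=4] z by (simp add: simps)
  have "3 * g 3 0 = 2 * g 3 0"
    using e2 by (simp flip: e1)
  then have "g 3 0 = 0"
    by simp
  then have 42: "g 4 2 = 0" "g 3 0 = 0"
    using e1 by simp_all
  have 31: "g 3 1 = 0"
    using c[where i=2 and n=1] z 42 by (simp add: simps)
  note z = z 42 31
  have e3: "3 * g 3 2 = 2 * g 2 0"
    using c[where i=1 and n=2] z by (simp add: simps)
  have e4: "g 3 2 = g 2 0"
    using c[where i=0 and n=4] z by (simp add: simps)
  have "g 2 0 = 0"
    using e3 by (simp add: e4)
  then have 20: "g 2 0 = 0" "g 3 2 = 0"
    using e4 by simp_all
  note z = z 20
  have e5: "3 * g 3 3 = 2 * g 2 1"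
    using c[where i=1 and n=1] z by (simp add: simps)
  have e6: "g 3 3 = g 2 1"
    using c[where i=0 and n=3] z by (simp add: simps)
  have "g 2 1 = 0"
    using e5 by (simp add: e6)
  then have 21: "g 2 1 = 0" "g 3 3 = 0"
    using e6 by simp_all
  note z = z 21
  show "g 2 0 = 0" "g 2 1 = 0" "g 3 0 = 0" "g 3 1 = 0" "g 3 2 = 0" "g 3 3 = 0"
    "g 4 0 = 0" "g 4 1 = 0" "g 4 2 = 0" "g 5 0 = 0" "g 5 1 = 0" "g 6 0 = 0"
    using z by simp_all
  show e7: "g 1 0 = g 2 2"
    using c[where i=0 and n=2] z by (simp add: simps)
  show "g 1 1 = g 2 3 + \<alpha> * g 2 2"
    using c[where i=0 and n=1] z e7 by (simp add: simps)
qed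

section \<open>The curves through the pole of the chart r2\<close>

definition polyfun :: "('k::comm_semiring_1 \<Rightarrow> 'k) \<Rightarrow> bool" where
  "polyfun f \<longleftrightarrow> (\<exists>p. \<forall>s. f s = poly p s)"

lemma polyfun_const: "polyfun (\<lambda>s. c)"
  unfolding polyfun_def by (rule exI[of _ "[:c:]"]) simp

lemma polyfun_id: "polyfun (\<lambda>s. s)"
  unfolding polyfun_def by (rule exI[of _ "[:0, 1:]"]) simp

lemma polyfun_add: "polyfun f \<Longrightarrow> polyfun g \<Longrightarrow> polyfun (\<lambda>s. f s + g s)"
  unfolding polyfun_def by (metis poly_add)

lemma polyfun_mult: "polyfun f \<Longrightarrow> polyfun g \<Longrightarrow> polyfun (\<lambda>s. f s * g s)"
  unfolding polyfun_def by (metis poly_mult)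

lemma polyfun_diff: "polyfun f \<Longrightarrow> polyfun g \<Longrightarrow> polyfun (\<lambda>s. f s - g s)"
  for f g :: "'k::comm_ring_1 \<Rightarrow> 'k"
  unfolding polyfun_def by (metis poly_diff)

lemma polyfun_uminus: "polyfun f \<Longrightarrow> polyfun (\<lambda>s. - f s)"
  for f :: "'k::comm_ring_1 \<Rightarrow> 'k"
  unfolding polyfun_def by (metis poly_minus)

lemma polyfun_power: "polyfun f \<Longrightarrow> polyfun (\<lambda>s. f s ^ n)"
  unfolding polyfun_def by (metis poly_power)

lemmas polyfun_intros = polyfun_const polyfun_id polyfun_add polyfun_mult
  polyfun_diff polyfun_uminus polyfun_power

text \<open>
  The way in which a missing pole is exploited: if \<open>f(s) / s\<close> has no pole at 0, then \<open>f\<close> vanishes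
  there.  The inverse of \<open>s\<close> is a variable \<open>u\<close> with \<open>s u = 1\<close>, so that the hypothesis becomes
  a polynomial identity modulo \<open>s u - 1\<close>, which Groebner bases decide.
\<close>
lemma polyfun_value_0:
  fixes f :: "'k::field_char_0 \<Rightarrow> 'k"
  assumes "polyfun f" and "\<And>s u. s * u = 1 \<Longrightarrow> f s = s * poly p s"
  shows "f 0 = 0"
proof -
  obtain q where q: "\<And>s. f s = poly q s"
    using assms(1) unfolding polyfun_def by blast
  have "q = [:0, 1:] * p"
  proof (rule poly_eqI_off_zero)
    fix s :: 'k assume "s \<noteq> 0"
    then have "s * (1 / s) = 1"
      by simp
    from assms(2)[OF this] show "poly q s = poly ([:0, 1:] * p) s"
      by (simp add: q)
  qed
  then show ?thesis
    by (simp add: q)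
qed

lemma poly_eq_0_off_zero:
  fixes p :: "'k::field_char_0 poly"
  assumes "\<And>y. y \<noteq> 0 \<Longrightarrow> poly p y = 0"
  shows "p = 0"
  using assms by (intro poly_eqI_off_zero) simp

lemma polyfun_leading_coeffs:
  fixes f :: "'k::field_char_0 \<Rightarrow> 'k"
  assumes "polyfun f"
    and "\<And>s u. s * u = 1 \<Longrightarrow> a + s * b + s ^ 2 * c + s ^ 3 * f s = s ^ 4 * poly p s"
  shows "a = 0" "b = 0" "c = 0" "f 0 = 0"
proof -
  obtain q where q: "\<And>s. f s = poly q s"
    using assms(1) unfolding polyfun_def by blast
  have "pCons a (pCons b (pCons c q)) = pCons 0 (pCons 0 (pCons 0 (pCons 0 p)))"
  proof (rule poly_eqI_off_zero)
    fix s :: 'k assume "s \<noteq> 0"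
    then have "s * (1 / s) = 1"
      by simp
    from assms(2)[OF this] show "poly (pCons a (pCons b (pCons c q))) s
        = poly (pCons 0 (pCons 0 (pCons 0 (pCons 0 p)))) s"
      by (simp add: q eval_nat_numeral algebra_simps)
  qed
  then show "a = 0" "b = 0" "c = 0" "f 0 = 0"
    by (simp_all add: q)
qed

text \<open>
  The form of \<open>K\<close> assumed here is the one that the other three charts leave over. It is restricted
  to the curves \<open>s \<mapsto> (1/s, t - w^2 - \<alpha>2 s, z + 2 w / s, w)\<close>, which is the chart \<open>r2\<close> at \<open>y2 = 0\<close>,
  with \<open>x2 = s\<close> and \<open>z2 = z\<close>. On them \<open>K + x\<close> must be a polynomial in \<open>s\<close>, so the principal part
  at \<open>s = 0\<close> vanishes. With \<open>\<eta> = t - w^2\<close>, the leading terms of \<open>x y^2\<close>, \<open>x^2 y^2\<close>, \<open>x^2 y^3\<close> and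
  \<open>x^2 y^4\<close> are \<open>\<eta>^2/s\<close>, \<open>\<eta>^2/s^2\<close>, \<open>\<eta>^3/s^2\<close> and \<open>\<eta>^4/s^2\<close>, and \<open>z\<close> has a pole exactly if
  \<open>w \<noteq> 0\<close>. The unknowns are eliminated by decreasing pole order; each vanishing leading
  coefficient is a polynomial in \<open>w\<close> (or in \<open>z\<close>, for \<open>w = 0\<close>), and hence vanishes coefficientwise.
  What remains at pole order 1 is inhomogeneous because of the summand \<open>x = 1/s\<close>; after
  multiplication by \<open>t^2\<close> its coefficient of \<open>w^4\<close> is \<open>t^2 F00 (\<alpha>0 + 2 \<alpha>1 + 2 \<alpha>2 + \<alpha>3) - 1\<close>: this
  is how the normalisation of the parameters fixes the scale of \<open>K\<close>.
\<close>
lemma r2_chart_determines: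
  fixes a0 a1 a2 a3 t :: "'k::field_char_0" and A :: "nat \<Rightarrow> 'k \<Rightarrow> 'k"
  assumes t: "t \<noteq> 0" and sum_a: "a0 + 2 * a1 + 2 * a2 + a3 = 1"
    and pol: "\<And>z w. \<exists>p. \<forall>s. s \<noteq> 0 \<longrightarrow>
      K (1 / s) (t - w ^ 2 - a2 * s) (z + 2 * w / s) w + 1 / s = poly p s"
    and K: "\<And>x y z w. K x y z w =
      A 0 w + A 1 w * z + A 2 w * z ^ 2 + A 3 w * z ^ 3 + A 4 w * z ^ 4 + A 5 w * z ^ 5
          + A 6 w * z ^ 6
      + (x * y ^ 2 - a1 * y) * (Q00 - a3 * Q12 * w + (Q10 + Q11 * w + Q12 * w ^ 2) * z + (Q20
          + Q21 * w) * z ^ 2 + Q30 * z ^ 3)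
      + (x + x ^ 2 * y ^ 2 + a0 * x * y) * (E00 + (E10 + E11 * w) * z + E20 * z ^ 2)
      + (x ^ 2 * y ^ 3 + x * y - a1 ^ 2 * y) * (F00 + F10 * z)
      + (x ^ 2 * y ^ 4 - 2 * a1 * x * y ^ 3 + a1 ^ 2 * y ^ 2) * G"
    and A0: "\<And>w. A 0 w = A00 - (a3 * A12 + a3 ^ 2 * A23) * w + a3 ^ 2 * A24 * w ^ 2"
    and A1: "\<And>w. A 1 w = A10 + A11 * w + A12 * w ^ 2 - 2 * a3 * A24 * w ^ 3"
    and A2: "\<And>w. A 2 w = A20 + A21 * w + A22 * w ^ 2 + A23 * w ^ 3 + A24 * w ^ 4"
    and A3: "\<And>w. A 3 w = A30 + A31 * w + A32 * w ^ 2 + A33 * w ^ 3"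
    and w: "w \<noteq> 0"
  shows "t ^ 2 * (K x y z w - A00) = x ^ 2 * y ^ 3 - (t * x + 2 * a1 + a2 + a3) * x * y ^ 2
          - ((a0 * t - 1) * x - a1 * (a1 + a2 + a3)) * y - t * x
          - 1 / 4 * z ^ 2 * w ^ 4 + 1 / 2 * a3 * z * w ^ 3
          + 1 / 4 * (2 * t * z ^ 2 - a3 ^ 2) * w ^ 2
          - 1 / 2 * ((a3 + 1) * t - 1) * z * w - 1 / 4 * t ^ 2 * z ^ 2
          + (x * y - a1) * y * z * w"
proof -
  define Ez where "Ez = (\<lambda>z. E00 + E10 * z + E20 * z ^ 2)"
  define Fz where "Fz = (\<lambda>z. F00 + F10 * z)"
  define Qz where "Qz = (\<lambda>z. Q00 + Q10 * z + Q20 * z ^ 2 + Q30 * z ^ 3)"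
  define Az where "Az = (\<lambda>z. A 0 0 + A 1 0 * z + A 2 0 * z ^ 2 + A 3 0 * z ^ 3 + A 4 0 * z ^ 4
      + A 5 0 * z ^ 5 + A 6 0 * z ^ 6)"
  have K0: "K x y z 0 = Az z + (x * y ^ 2 - a1 * y) * Qz z + (x + x ^ 2 * y ^ 2 + a0 * x * y) * Ez z
      + (x ^ 2 * y ^ 3 + x * y - a1 ^ 2 * y) * Fz z
      + (x ^ 2 * y ^ 4 - 2 * a1 * x * y ^ 3 + a1 ^ 2 * y ^ 2) * G" for x y z
    by (simp add: K Az_def Qz_def Ez_def Fz_def)
  have pol_u: "\<exists>p. \<forall>s u. s * u = 1 \<longrightarrow>
      K u (t - w ^ 2 - a2 * s) (z + 2 * w * u) w + u = poly p s" for z w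
  proof -
    obtain p where p: "\<And>s. s \<noteq> 0 \<Longrightarrow>
        K (1 / s) (t - w ^ 2 - a2 * s) (z + 2 * w / s) w + 1 / s = poly p s"
      using pol by blast
    have "K u (t - w ^ 2 - a2 * s) (z + 2 * w * u) w + u = poly p s" if su: "s * u = 1" for s u
    proof -
      have "s \<noteq> 0"
        using su by auto
      with su have "u = 1 / s"
        by (simp add: eq_divide_eq mult.commute)
      note \<open>s \<noteq> 0\<close> this
      then show ?thesis
        using p[of s] by simp
    qed
    then show ?thesis by blast
  qed
  \<comment> \<open>The double pole for \<open>w = 0\<close>.\<close>
  have E: "Ez z = - t * Fz z - t ^ 2 * G" for z
  proof -
    obtain p where p: "\<And>s u. s * u = 1 \<Longrightarrow> K u (t - a2 * s) z 0 + u = poly p s"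
      using pol_u[of 0 z] by auto
    define N where "N = (\<lambda>s. s ^ 2 * Az z + s * ((t - a2 * s) ^ 2 - a1 * (t - a2 * s) * s) * Qz z
        + (s + (t - a2 * s) ^ 2 + a0 * (t - a2 * s) * s) * Ez z
        + ((t - a2 * s) ^ 3 + s * (t - a2 * s) - a1 ^ 2 * (t - a2 * s) * s ^ 2) * Fz z
        + ((t - a2 * s) ^ 4 - 2 * a1 * (t - a2 * s) ^ 3 * s
            + a1 ^ 2 * (t - a2 * s) ^ 2 * s ^ 2) * G + s)"
    have "N 0 = 0"
    proof (rule polyfun_value_0)
      show "polyfun N"
        unfolding N_def by (intro polyfun_intros)
      fix s u :: 'k assume su: "s * u = 1"
      have "N s = s * (s * (K u (t - a2 * s) z 0 + u))"
        unfolding N_def K0 using su by algebra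
      then show "N s = s * poly ([:0, 1:] * p) s"
        by (simp add: p[OF su])
    qed
    moreover have "N 0 = t ^ 2 * (Ez z + t * Fz z + t ^ 2 * G)"
      by (simp add: N_def algebra_simps eval_nat_numeral)
    ultimately have "t ^ 2 * (Ez z + t * Fz z + t ^ 2 * G) = 0"
      by simp
    with t have "Ez z + t * Fz z + t ^ 2 * G = 0"
      by simp
    then show ?thesis by algebra
  qed
  \<comment> \<open>The simple pole for \<open>w = 0\<close>: the double pole is cancelled by the previous relation, since
    \<open>y - t\<close> is a multiple of \<open>s\<close>.\<close>
  have Q: "t ^ 2 * Qz z - t ^ 2 * (a0 + a2) * Fz z - t ^ 2 * (1 + a0 * t + 2 * a1 * t
      + 2 * a2 * t) * G + 1 = 0" for z
  proof -
    obtain p where p: "\<And>s u. s * u = 1 \<Longrightarrow> K u (t - a2 * s) z 0 + u = poly p s"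
      using pol_u[of 0 z] by auto
    define N where "N = (\<lambda>s. s * Az z + ((t - a2 * s) ^ 2 - a1 * (t - a2 * s) * s) * Qz z
        + (- a2 * (t - a2 * s) ^ 2 - t - t * a0 * (t - a2 * s) + (t - a2 * s)
            - a1 ^ 2 * (t - a2 * s) * s) * Fz z
        + (- a2 * (t - a2 * s) ^ 2 * (2 * t - a2 * s) - 2 * a1 * (t - a2 * s) ^ 3
            + a1 ^ 2 * (t - a2 * s) ^ 2 * s
           - t ^ 2 - t ^ 2 * a0 * (t - a2 * s)) * G + 1)"
    have "N 0 = 0"
    proof (rule polyfun_value_0)
      show "polyfun N"
        unfolding N_def by (intro polyfun_intros)
      fix s u :: 'k assume su: "s * u = 1"
      have "N s = s * (K u (t - a2 * s) z 0 + u)"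
        unfolding N_def K0 E using su by algebra
      then show "N s = s * poly p s"
        by (simp add: p[OF su])
    qed
    then show ?thesis
      by (simp add: N_def algebra_simps eval_nat_numeral)
  qed
  have E_coeffs: "E00 = - t * F00 - t ^ 2 * G" "E10 = - t * F10" "E20 = 0"
  proof -
    have "poly [:E00 + t * F00 + t ^ 2 * G, E10 + t * F10, E20:] z = 0" for z
      using E[of z] unfolding Ez_def Fz_def by (simp only: poly_pCons poly_0) algebra
    then have "[:E00 + t * F00 + t ^ 2 * G, E10 + t * F10, E20:] = 0"
      by (intro poly_eq_0_off_zero)
    then show "E00 = - t * F00 - t ^ 2 * G" "E10 = - t * F10" "E20 = 0"
      by (simp_all add: eq_neg_iff_add_eq_0 algebra_simps)
  qed
  have Q_coeffs: "t ^ 2 * Q00 - t ^ 2 * (a0 + a2) * F00 - t ^ 2 * (1 + a0 * t + 2 * a1 * t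
      + 2 * a2 * t) * G + 1 = 0"
    "Q10 = (a0 + a2) * F10" "Q20 = 0" "Q30 = 0"
  proof -
    have "poly [:t ^ 2 * Q00 - t ^ 2 * (a0 + a2) * F00 - t ^ 2 * (1 + a0 * t + 2 * a1 * t
        + 2 * a2 * t) * G + 1,
       t ^ 2 * (Q10 - (a0 + a2) * F10), t ^ 2 * Q20, t ^ 2 * Q30:] z = 0" for z
      using Q[of z] unfolding Qz_def Fz_def by (simp only: poly_pCons poly_0) algebra
    then have "[:t ^ 2 * Q00 - t ^ 2 * (a0 + a2) * F00 - t ^ 2 * (1 + a0 * t + 2 * a1 * t
        + 2 * a2 * t) * G + 1,
       t ^ 2 * (Q10 - (a0 + a2) * F10), t ^ 2 * Q20, t ^ 2 * Q30:] = 0"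
      by (intro poly_eq_0_off_zero)
    with t show "t ^ 2 * Q00 - t ^ 2 * (a0 + a2) * F00 - t ^ 2 * (1 + a0 * t + 2 * a1 * t
        + 2 * a2 * t) * G + 1 = 0"
    "Q10 = (a0 + a2) * F10" "Q20 = 0" "Q30 = 0"
      by simp_all
  qed
  \<comment> \<open>For \<open>w \<noteq> 0\<close> the powers of \<open>z\<close> produce the poles of order 6, 5, 4 and 3, and only at order 3
    do the other summands interfere.  The curve with \<open>z2 = 0\<close> suffices.\<close>
  have B: "A 6 w = 0" "A 5 w = 0" "A 4 w = 0"
      "4 * w * A 3 w + 2 * w * (t - w ^ 2) ^ 2 * Q21 + (t - w ^ 2) ^ 2 * (E11 - w * F10) = 0"
    if w: "w \<noteq> 0" for w
  proof -
    define y where "y = (\<lambda>s. t - w ^ 2 - a2 * s)"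
    obtain p where p: "\<And>s u. s * u = 1 \<Longrightarrow> K u (y s) (2 * w * u) w + u = poly p s"
      using pol_u[of w 0] unfolding y_def by auto
    define R where "R = (\<lambda>s. A 3 w * (2 * w) ^ 3 + A 2 w * (2 * w) ^ 2 * s + A 1 w * (2 * w) * s ^ 2
      + A 0 w * s ^ 3
      + (y s ^ 2 - a1 * y s * s) * ((Q00 - a3 * Q12 * w) * s ^ 2 + (Q10 + Q11 * w
          + Q12 * w ^ 2) * (2 * w) * s + Q21 * w * (2 * w) ^ 2)
      + (s + y s ^ 2 + a0 * y s * s) * (E00 * s + (E10 + E11 * w) * (2 * w))
      + (y s ^ 3 + s * y s - a1 ^ 2 * y s * s ^ 2) * (F00 * s + F10 * (2 * w))
      + (y s ^ 4 - 2 * a1 * y s ^ 3 * s + a1 ^ 2 * y s ^ 2 * s ^ 2) * G * s + s ^ 2)"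
    have R_poly: "polyfun R"
      unfolding R_def y_def by (intro polyfun_intros)
    have R_eq: "A 6 w * (2 * w) ^ 6 + s * (A 5 w * (2 * w) ^ 5) + s ^ 2 * (A 4 w * (2 * w) ^ 4)
        + s ^ 3 * R s
        = s ^ 4 * poly ([:0, 0, 1:] * p) s" if su: "s * u = 1" for s u
    proof -
      have "A 6 w * (2 * w) ^ 6 + s * (A 5 w * (2 * w) ^ 5) + s ^ 2 * (A 4 w * (2 * w) ^ 4)
          + s ^ 3 * R s
        = s ^ 4 * (s * s * (K u (y s) (2 * w * u) w + u))"
        unfolding R_def K E_coeffs(3) Q_coeffs(3,4) using su by algebra
      then show ?thesis
        unfolding p[OF su] by simp
    qed
    note lead = polyfun_leading_coeffs[OF R_poly R_eq]
    show "A 6 w = 0" "A 5 w = 0" "A 4 w = 0"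
      using lead(1-3) w by simp_all
    \<comment> \<open>The factor \<open>w^2\<close> appears because \<open>E10 = - t F10\<close> and \<open>t - w^2 - t = - w^2\<close>.\<close>
    have "2 * w ^ 2 * (4 * w * A 3 w + 2 * w * (t - w ^ 2) ^ 2 * Q21
        + (t - w ^ 2) ^ 2 * (E11 - w * F10)) = 0"
      using lead(4) unfolding R_def y_def E_coeffs by (simp add: algebra_simps eval_nat_numeral)
    then show "4 * w * A 3 w + 2 * w * (t - w ^ 2) ^ 2 * Q21 + (t - w ^ 2) ^ 2 * (E11 - w * F10)
        = 0"
      using w by simp
  qed
  have E11: "E11 = 0" and F10: "F10 = 2 * Q21"
  proof -
    let ?p = "[:t ^ 2 * E11, 4 * A30 + t ^ 2 * (2 * Q21 - F10), 4 * A31 - 2 * t * E11,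
      4 * A32 - 2 * t * (2 * Q21 - F10), 4 * A33 + E11, 2 * Q21 - F10:]"
    have "poly ?p w = 0" if "w \<noteq> 0" for w
      using B(4)[OF that] unfolding A3 by (simp only: poly_pCons poly_0) algebra
    then have "?p = 0"
      by (rule poly_eq_0_off_zero)
    with t show "E11 = 0" "F10 = 2 * Q21"
      by simp_all
  qed
  have A3_0: "A 3 w = 0" if "w \<noteq> 0" for w
    using B(4)[OF that] that unfolding E11 F10 by (simp add: algebra_simps)
  \<comment> \<open>The double pole for \<open>w \<noteq> 0\<close>.  Since \<open>F10 = 2 Q21\<close> and \<open>E10 = - t F10\<close>, the triple poles of the
    summands with \<open>Q21\<close> cancel, by \<open>w^2 = t - \<eta>\<close>, and the last summand of \<open>N\<close> is what they leave.
    The parameter is taken as \<open>z2 = 2 z\<close> to avoid a fraction.\<close>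
  have C: "4 * w ^ 2 * A 2 w + 2 * w * (t - w ^ 2) ^ 2 * (Q10 + Q11 * w + Q12 * w ^ 2)
      + (t - w ^ 2) ^ 2 * E00 + (t - w ^ 2) ^ 3 * F00 + (t - w ^ 2) ^ 4 * G
      + 2 * Q21 * (2 * w) * (w * z * (t - w ^ 2) ^ 2
         - a2 * (t - w ^ 2) ^ 2 - a1 * (t - w ^ 2) * w ^ 2 - t - t * a0 * (t - w ^ 2)
             + (t - w ^ 2)) = 0"
    if w: "w \<noteq> 0" for w z
  proof -
    define y where "y = (\<lambda>s. t - w ^ 2 - a2 * s)"
    obtain p where p: "\<And>s u. s * u = 1 \<Longrightarrow> K u (y s) (2 * z + 2 * w * u) w + u = poly p s"
      using pol_u[of w "2 * z"] unfolding y_def by auto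
    define N where "N = (\<lambda>s. A 2 w * (2 * z * s + 2 * w) ^ 2 + A 1 w * s * (2 * z * s + 2 * w)
        + A 0 w * s ^ 2
      + (y s ^ 2 - a1 * y s * s) * ((Q00 - a3 * Q12 * w) * s + (Q10 + Q11 * w
          + Q12 * w ^ 2) * (2 * z * s + 2 * w))
      + (s + y s ^ 2 + a0 * y s * s) * E00 + (y s ^ 3 + s * y s - a1 ^ 2 * y s * s ^ 2) * F00
      + (y s ^ 4 - 2 * a1 * y s ^ 3 * s + a1 ^ 2 * y s ^ 2 * s ^ 2) * G + s
      + 2 * Q21 * (2 * z * s + 2 * w) * (w * z * (y s ^ 2 - a1 * y s * s)
         - a2 * y s ^ 2 - a1 * y s * w ^ 2 - t - t * a0 * y s + y s - a1 ^ 2 * y s * s))"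
    have "N 0 = 0"
    proof (rule polyfun_value_0)
      show "polyfun N"
        unfolding N_def y_def by (intro polyfun_intros)
      fix s u :: 'k assume su: "s * u = 1"
      have "y s = t - w ^ 2 - a2 * s"
        by (simp add: y_def)
      then have "N s = s * (s * (K u (y s) (2 * z + 2 * w * u) w + u))"
        unfolding N_def K E_coeffs(2,3) Q_coeffs(3,4) B(1-3)[OF w] A3_0[OF w] E11 F10 
        using su by algebra
      then show "N s = s * poly ([:0, 1:] * p) s"
        by (simp add: p[OF su])
    qed
    then show ?thesis
      unfolding N_def y_def by (simp add: algebra_simps)
  qed
  have "Q21 * (w ^ 2 * (t - w ^ 2) ^ 2) = 0" if "w \<noteq> 0" for w
  proof -
    have "4 * (Q21 * (w ^ 2 * (t - w ^ 2) ^ 2)) = 0"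
      using C[OF that, of 1] C[OF that, of 0] by algebra
    then show ?thesis by simp
  qed
  \<comment> \<open>At most one of \<open>w = 1\<close> and \<open>w = 2\<close> satisfies \<open>w^2 = t\<close>.\<close>
  from this[of 1] this[of 2] have Q21: "Q21 = 0"
    by auto
  have F10_0: "F10 = 0" and Q10: "Q10 = 0" and E10: "E10 = 0"
    using F10 Q21 Q_coeffs(2) E_coeffs(2) by simp_all
  have C': "4 * A 2 w + 2 * (t - w ^ 2) ^ 2 * (Q11 + Q12 * w) - (t - w ^ 2) ^ 2 * F00
      - (t - w ^ 2) ^ 2 * (2 * t - w ^ 2) * G = 0" if w: "w \<noteq> 0" for w
  proof -
    have "w ^ 2 * (4 * A 2 w + 2 * (t - w ^ 2) ^ 2 * (Q11 + Q12 * w) - (t - w ^ 2) ^ 2 * F00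
      - (t - w ^ 2) ^ 2 * (2 * t - w ^ 2) * G) = 0"
      using C[OF w, of 0] unfolding Q21 Q10 E_coeffs(1) by algebra
    with w show ?thesis by simp
  qed
  have G: "G = 0" and Q12: "Q12 = 0" and A23: "A23 = 0" and A24: "4 * A24 = F00 - 2 * Q11"
  proof -
    let ?p = "[:4 * A20 + t ^ 2 * (2 * Q11 - F00) - 2 * t ^ 3 * G, 4 * A21 + 2 * t ^ 2 * Q12,
      4 * A22 - 2 * t * (2 * Q11 - F00) + 5 * t ^ 2 * G, 4 * A23 - 4 * t * Q12,
      4 * A24 + (2 * Q11 - F00) - 4 * t * G, 2 * Q12, G:]"
    have "poly ?p w = 0" if "w \<noteq> 0" for w
      using C'[OF that] unfolding A2 by (simp only: poly_pCons poly_0) algebra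
    then have "?p = 0"
      by (rule poly_eq_0_off_zero)
    then show "G = 0" "Q12 = 0" "A23 = 0" "4 * A24 = F00 - 2 * Q11"
      by (simp_all add: algebra_simps eq_diff_eq)
  qed
  have A2': "4 * A 2 w = (t - w ^ 2) ^ 2 * (F00 - 2 * Q11)" if "w \<noteq> 0" for w
    using C'[OF that] unfolding G Q12 by algebra
  \<comment> \<open>The simple pole for \<open>w \<noteq> 0\<close>: the double poles cancel by \<open>A2'\<close>, because \<open>y^2 - \<eta>^2\<close> and
    \<open>y - t + w^2\<close> are multiples of \<open>s\<close>.\<close>
  have D: "4 * w * z * A 2 w + 2 * w * A 1 w + (t - w ^ 2) ^ 2 * Q00 + Q11 * w * z * (t - w ^ 2) ^ 2
      - 2 * (2 * a2 + a1) * w ^ 2 * (t - w ^ 2) * Q11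
      + F00 * (2 * w ^ 2 * a2 * (t - w ^ 2) - a2 * (t - w ^ 2) ^ 2 + (t - w ^ 2) - t
          - t * a0 * (t - w ^ 2)) + 1 = 0"
    if w: "w \<noteq> 0" for w z
  proof -
    define y where "y = (\<lambda>s. t - w ^ 2 - a2 * s)"
    obtain p where p: "\<And>s u. s * u = 1 \<Longrightarrow> K u (y s) (z + 2 * w * u) w + u = poly p s"
      using pol_u[of w z] unfolding y_def by auto
    define N where "N = (\<lambda>s. A 2 w * (z ^ 2 * s + 4 * w * z) + A 1 w * (z * s + 2 * w) + A 0 w * s
      + (y s ^ 2 - a1 * y s * s) * (Q00 + Q11 * w * z)
      - 2 * Q11 * w ^ 2 * (a2 * (y s + t - w ^ 2) + a1 * y s)
      + F00 * (w ^ 2 * a2 * (y s + t - w ^ 2) - a2 * y s ^ 2 + y s - a1 ^ 2 * y s * s - t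
          - t * a0 * y s) + 1)"
    have "N 0 = 0"
    proof (rule polyfun_value_0)
      show "polyfun N"
        unfolding N_def y_def by (intro polyfun_intros)
      fix s u :: 'k assume su: "s * u = 1"
      have "y s = t - w ^ 2 - a2 * s"
        by (simp add: y_def)
      then have "N s = s * (K u (y s) (z + 2 * w * u) w + u)"
        unfolding N_def K E_coeffs(1,3) E10 E11 Q10 Q12 Q21 Q_coeffs(3,4) G F10_0 B(1-3)[OF w]
            A3_0[OF w]
        using su A2'[OF w] by algebra
      then show "N s = s * poly p s"
        by (simp add: p[OF su])
    qed
    then show ?thesis
      unfolding N_def y_def by (simp add: algebra_simps)
  qed
  have "(Q11 - F00) * (w * (t - w ^ 2) ^ 2) = 0" if "w \<noteq> 0" for w
    using D[OF that, of 1] D[OF that, of 0] A2'[OF that] by algebra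
  from this[of 1] this[of 2] have Q11: "Q11 = F00"
    by auto
  have Q00: "t ^ 2 * Q00 = t ^ 2 * (a0 + a2) * F00 - 1"
    using Q_coeffs(1) unfolding G by algebra
  have A24': "4 * A24 = - F00"
    using A24 unfolding Q11 by algebra
  have A10: "A10 = 0" and A12: "A12 = 0" and F00: "t ^ 2 * F00 = 1"
    and A11: "2 * t ^ 2 * A11 = t * (1 - a3) + 1 - 2 * t"
  proof -
    let ?p = "[:0, 2 * t ^ 2 * A10, 2 * t ^ 2 * A11 + 2 * t - t ^ 2 * F00 * (t * (a0 + 2 * a1
        + 2 * a2) + 1),
      2 * t ^ 2 * A12, t ^ 2 * F00 * (a0 + 2 * a1 + 2 * a2 + a3) - 1:]"
    have "poly ?p w = 0" if "w \<noteq> 0" for w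
      using D[OF that, of 0] Q00 A24' unfolding A1 Q11 by (simp only: poly_pCons poly_0) algebra
    then have p: "?p = 0"
      by (rule poly_eq_0_off_zero)
    with t show "A10 = 0" "A12 = 0"
      by simp_all
    from p show F00: "t ^ 2 * F00 = 1"
      by (simp add: sum_a)
    from p have "2 * t ^ 2 * A11 + 2 * t - t ^ 2 * F00 * (t * (a0 + 2 * a1 + 2 * a2) + 1) = 0"
      by simp
    with F00 sum_a show "2 * t ^ 2 * A11 = t * (1 - a3) + 1 - 2 * t"
      by algebra
  qed
  define half quarter :: 'k where half_def: "half = 1 / 2" and quarter_def: "quarter = 1 / 4"
  have hq: "1 / 2 = half" "1 / 4 = quarter" "2 * half = 1" "4 * quarter = 1"
    unfolding half_def quarter_def by simp_all
  have "A 2 w = - quarter * (t - w ^ 2) ^ 2 * F00"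
    using A2'[OF w] hq(4) unfolding Q11 by algebra
  moreover have "A24 = - quarter * F00"
    using A24' hq(4) by algebra
  moreover have "t ^ 2 * A11 = half * (t * (1 - a3) + 1 - 2 * t)"
    using A11 hq(3) by algebra
  ultimately show ?thesis
    unfolding K E_coeffs(1,3) E10 E11 Q10 Q12 Q21 Q_coeffs(3,4) G F10_0 B(1-3)[OF w] A3_0[OF w]
      A0 A1 A10 A12 A23 Q11 hq(1,2)
    using F00 Q00 sum_a hq(3,4) by algebra
qed

section \<open>The normal form\<close>

text \<open>
  The normal form: the combinations of the five polynomials in \<open>x\<close>, \<open>y\<close> named at the top, with the
  restricted coefficients in \<open>z\<close>, \<open>w\<close>.  All free parameters are coefficients of \<open>K\<close> itself.
\<close>
lemma normal_form:
  fixes K :: "ratt poly4"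
  defines "\<kappa> \<equiv> coeff4 K"
  defines "A \<equiv> (\<lambda>c w. \<Sum>d\<le>6. \<kappa> 0 0 c d * w ^ d)"
  assumes deg: "total_degree K \<le> 6"
    and r0: "polynomial_in_coords K (r0 \<alpha>0)"
    and r1: "polynomial_in_coords K (r1 \<alpha>1)"
    and r3: "polynomial_in_coords K (r3 \<alpha>3)"
  shows "eval4 K (coords x y z w) =
      A 0 w + A 1 w * z + A 2 w * z ^ 2 + A 3 w * z ^ 3 + A 4 w * z ^ 4 + A 5 w * z ^ 5
          + A 6 w * z ^ 6
      + (x * y ^ 2 - cst \<alpha>1 * y) * (\<kappa> 1 2 0 0 - cst \<alpha>3 * \<kappa> 1 2 1 2 * w
        + (\<kappa> 1 2 1 0 + \<kappa> 1 2 1 1 * w + \<kappa> 1 2 1 2 * w ^ 2) * z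
        + (\<kappa> 1 2 2 0 + \<kappa> 1 2 2 1 * w) * z ^ 2 + \<kappa> 1 2 3 0 * z ^ 3)
      + (x + x ^ 2 * y ^ 2 + cst \<alpha>0 * x * y)
        * (\<kappa> 2 2 0 0 + (\<kappa> 2 2 1 0 + \<kappa> 2 2 1 1 * w) * z + \<kappa> 2 2 2 0 * z ^ 2)
      + (x ^ 2 * y ^ 3 + x * y - cst \<alpha>1 ^ 2 * y) * (\<kappa> 2 3 0 0 + \<kappa> 2 3 1 0 * z)
      + (x ^ 2 * y ^ 4 - 2 * cst \<alpha>1 * x * y ^ 3 + cst \<alpha>1 ^ 2 * y ^ 2) * \<kappa> 2 4 0 0"
    and "A 0 w = \<kappa> 0 0 0 0 - (cst \<alpha>3 * \<kappa> 0 0 1 2 + cst \<alpha>3 ^ 2 * \<kappa> 0 0 2 3) * w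
      + cst \<alpha>3 ^ 2 * \<kappa> 0 0 2 4 * w ^ 2"
    "A 1 w = \<kappa> 0 0 1 0 + \<kappa> 0 0 1 1 * w + \<kappa> 0 0 1 2 * w ^ 2 - 2 * cst \<alpha>3 * \<kappa> 0 0 2 4 * w ^ 3"
    "A 2 w = \<kappa> 0 0 2 0 + \<kappa> 0 0 2 1 * w + \<kappa> 0 0 2 2 * w ^ 2 + \<kappa> 0 0 2 3 * w ^ 3
        + \<kappa> 0 0 2 4 * w ^ 4"
    "A 3 w = \<kappa> 0 0 3 0 + \<kappa> 0 0 3 1 * w + \<kappa> 0 0 3 2 * w ^ 2 + \<kappa> 0 0 3 3 * w ^ 3"
proof -
  define F where "F = (\<lambda>a b z w. \<Sum>c\<le>6. \<Sum>d\<le>6. \<kappa> a b c d * z ^ c * w ^ d)"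
  have eval_K: "eval4 K (coords x y z w) = (\<Sum>a\<le>6. \<Sum>b\<le>6. F a b z w * x ^ a * y ^ b)" for x y z w
    unfolding F_def \<kappa>_def using deg by (rule eval4_coords)
  have \<kappa>_0: "\<kappa> a b c d = 0" if "a + b + c + d > 6" for a b c d
    using that deg by (simp add: \<kappa>_def coeff4_eq_0)
  have F_0: "F a b z w = 0" if "a + b > 6" for a b z w
    using that by (simp add: F_def \<kappa>_0)

  \<comment> \<open>\<open>r0\<close> and \<open>r1\<close> act on \<open>x\<close>, \<open>y\<close> only, so their relations hold for the coefficients \<open>F a b\<close> at
    each \<open>z\<close>, \<open>w\<close>.\<close>
  obtain P0 where "\<And>x y z w. y \<noteq> 0 \<Longrightarrow>
      eval4 K (coords (x - cst \<alpha>0 / y - 1 / y ^ 2) y z w) = eval4 P0 (coords x y z w)"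
    using chart_r0[OF r0] by blast
  then have "(\<Sum>a\<le>6. \<Sum>b\<le>6. F a b z w * (x - cst \<alpha>0 / y - 1 / y ^ 2) ^ a * y ^ b)
      = (\<Sum>i\<le>total_degree P0. \<Sum>j\<le>total_degree P0. (\<Sum>c\<le>total_degree P0. \<Sum>d\<le>total_degree P0.
           coeff4 P0 i j c d * z ^ c * w ^ d) * x ^ i * y ^ j)" if "y \<noteq> 0" for x y z w
    using that by (simp only: eval_K[symmetric] eval4_coords[OF order_refl, symmetric])
  note rel0 = shift_relations[OF this F_0]

  obtain P1 where "\<And>x y z w. y \<noteq> 0 \<Longrightarrow>
      eval4 K (coords ((cst \<alpha>1 - x * y) * y) (1 / y) z w) = eval4 P1 (coords x y z w)"
    using chart_r1[OF r1] by blast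
  then have "(\<Sum>a\<le>6. \<Sum>b\<le>6. F a b z w * ((cst \<alpha>1 - x * y) * y) ^ a * (1 / y) ^ b)
      = (\<Sum>i\<le>total_degree P1. \<Sum>j\<le>total_degree P1. (\<Sum>c\<le>total_degree P1. \<Sum>d\<le>total_degree P1.
           coeff4 P1 i j c d * z ^ c * w ^ d) * x ^ i * y ^ j)" if "y \<noteq> 0" for x y z w
    using that by (simp only: eval_K[symmetric] eval4_coords[OF order_refl, symmetric])
  note rel1 = inversion_relations[OF this F_0]

  \<comment> \<open>\<open>r3\<close> acts on \<open>z\<close>, \<open>w\<close> only, so its relations hold for each coefficient in \<open>x\<close>, \<open>y\<close>;
    they are those of \<open>r1\<close> up to the names of the variables.\<close>
  obtain P3 where P3: "\<And>x y z w. w \<noteq> 0 \<Longrightarrow>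
      eval4 K (coords x y ((cst \<alpha>3 - z * w) * w) (1 / w)) = eval4 P3 (coords x y z w)"
    using chart_r3[OF r3] by blast
  \<comment> \<open>The maximum makes room for the comparison with the terms of \<open>K\<close>, which are indexed up to 6.\<close>
  define N where "N = max 6 (total_degree P3)"
  have "(\<Sum>c\<le>6. \<Sum>d\<le>6. \<kappa> a b c d * ((cst \<alpha>3 - z * w) * w) ^ c * (1 / w) ^ d)
      = (\<Sum>i\<le>N. \<Sum>j\<le>N. coeff4 P3 a b i j * z ^ i * w ^ j)" if "w \<noteq> 0" "a \<le> 6" "b \<le> 6" for a b z w
  proof (rule sum_powers2_eqD[OF _ \<open>a \<le> 6\<close> \<open>b \<le> 6\<close>])
    fix x y
    show "(\<Sum>a\<le>6. \<Sum>b\<le>6. (\<Sum>c\<le>6. \<Sum>d\<le>6. \<kappa> a b c d * ((cst \<alpha>3 - z * w) * w) ^ c * (1 / w) ^ d) * x ^ a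
        * y ^ b)
      = (\<Sum>a\<le>N. \<Sum>b\<le>N. (\<Sum>i\<le>N. \<Sum>j\<le>N. coeff4 P3 a b i j * z ^ i * w ^ j) * x ^ a * y ^ b)"
      using P3[OF \<open>w \<noteq> 0\<close>, of x y z] eval4_coords[of P3 N x y z w] deg
      by (simp add: eval4_coords[of K 6] N_def \<kappa>_def)
  qed (simp add: N_def)
  note rel3 = inversion_relations[where g = "\<kappa> a b" and p
      = "coeff4 P3 a b" for a b, OF this \<kappa>_0, simplified]

  \<comment> \<open>The coefficient of \<open>x^a y^b\<close> has degree at most \<open>6 - a - b\<close> in \<open>z\<close>, \<open>w\<close>, so few terms are left
    once the relations of \<open>r3\<close> are taken into account.\<close>
  note expand = F_def sum_atMost_6 \<kappa>_0 algebra_simps numeral_2_eq_2[symmetric]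
  have F22: "F 2 2 z w = \<kappa> 2 2 0 0 + (\<kappa> 2 2 1 0 + \<kappa> 2 2 1 1 * w) * z
      + \<kappa> 2 2 2 0 * z ^ 2" for z w
    using rel3(7,8)[of 2 2] by (simp add: expand)
  have F23: "F 2 3 z w = \<kappa> 2 3 0 0 + \<kappa> 2 3 1 0 * z" for z w
    using rel3(7)[of 2 3] by (simp add: expand)
  have F24: "F 2 4 z w = \<kappa> 2 4 0 0" for z w
    by (simp add: expand)
  have F12: "F 1 2 z w = \<kappa> 1 2 0 0 - cst \<alpha>3 * \<kappa> 1 2 1 2 * w
      + (\<kappa> 1 2 1 0 + \<kappa> 1 2 1 1 * w + \<kappa> 1 2 1 2 * w ^ 2) * z
      + (\<kappa> 1 2 2 0 + \<kappa> 1 2 2 1 * w) * z ^ 2 + \<kappa> 1 2 3 0 * z ^ 3" for z w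
    using rel3(1,7,8)[of 1 2] by (simp add: expand)
  have F00: "F 0 0 z w = A 0 w + A 1 w * z + A 2 w * z ^ 2 + A 3 w * z ^ 3 + A 4 w * z ^ 4
      + A 5 w * z ^ 5 + A 6 w * z ^ 6" for z w
    unfolding F_def A_def by (simp add: sum_atMost_6 algebra_simps numeral_2_eq_2[symmetric])
  show "eval4 K (coords x y z w) =
      A 0 w + A 1 w * z + A 2 w * z ^ 2 + A 3 w * z ^ 3 + A 4 w * z ^ 4 + A 5 w * z ^ 5
          + A 6 w * z ^ 6
      + (x * y ^ 2 - cst \<alpha>1 * y) * (\<kappa> 1 2 0 0 - cst \<alpha>3 * \<kappa> 1 2 1 2 * w
        + (\<kappa> 1 2 1 0 + \<kappa> 1 2 1 1 * w + \<kappa> 1 2 1 2 * w ^ 2) * z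
        + (\<kappa> 1 2 2 0 + \<kappa> 1 2 2 1 * w) * z ^ 2 + \<kappa> 1 2 3 0 * z ^ 3)
      + (x + x ^ 2 * y ^ 2 + cst \<alpha>0 * x * y)
        * (\<kappa> 2 2 0 0 + (\<kappa> 2 2 1 0 + \<kappa> 2 2 1 1 * w) * z + \<kappa> 2 2 2 0 * z ^ 2)
      + (x ^ 2 * y ^ 3 + x * y - cst \<alpha>1 ^ 2 * y) * (\<kappa> 2 3 0 0 + \<kappa> 2 3 1 0 * z)
      + (x ^ 2 * y ^ 4 - 2 * cst \<alpha>1 * x * y ^ 3 + cst \<alpha>1 ^ 2 * y ^ 2) * \<kappa> 2 4 0 0"
    unfolding F00[symmetric] F12[symmetric] F22[symmetric] F23[of z w, symmetric] F24[of z w,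
        symmetric] eval_K
    by (simp add: sum_atMost_6 F_0 rel0[unfolded One_nat_def] rel1[unfolded One_nat_def]
      numeral_2_eq_2[symmetric]) (simp add: algebra_simps)
  show "A 0 w = \<kappa> 0 0 0 0 - (cst \<alpha>3 * \<kappa> 0 0 1 2 + cst \<alpha>3 ^ 2 * \<kappa> 0 0 2 3) * w
      + cst \<alpha>3 ^ 2 * \<kappa> 0 0 2 4 * w ^ 2"
    "A 1 w = \<kappa> 0 0 1 0 + \<kappa> 0 0 1 1 * w + \<kappa> 0 0 1 2 * w ^ 2 - 2 * cst \<alpha>3 * \<kappa> 0 0 2 4 * w ^ 3"
    "A 2 w = \<kappa> 0 0 2 0 + \<kappa> 0 0 2 1 * w + \<kappa> 0 0 2 2 * w ^ 2 + \<kappa> 0 0 2 3 * w ^ 3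
        + \<kappa> 0 0 2 4 * w ^ 4"
    "A 3 w = \<kappa> 0 0 3 0 + \<kappa> 0 0 3 1 * w + \<kappa> 0 0 3 2 * w ^ 2 + \<kappa> 0 0 3 3 * w ^ 3"
    by (simp_all add: A_def expand rel3[of 0 0, unfolded One_nat_def])
qed

text \<open>
  The points with second coordinate 0 in the chart \<open>r2\<close> already carry enough information.
\<close>
lemma polynomial_on_r2_curves:
  assumes "polynomial_in_coords (K + Var VX) (r2 \<alpha>2)"
  shows "\<exists>p. \<forall>s. s \<noteq> 0 \<longrightarrow> eval4 K (coords (1 / s) (tvar - w ^ 2 - cst \<alpha>2 * s) (z + 2 * w / s) w)
    + 1 / s = poly p s"
proof -
  let ?K = "\<lambda>x y z w. eval4 K (coords x y z w)"
  obtain P2 where P2: "\<And>x y z w. x \<noteq> 0 \<Longrightarrow>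
    eval4 (K + Var VX) (coords (1 / x) (tvar - w ^ 2 - cst \<alpha>2 * x - y * x ^ 2) (z + 2 * w / x) w)
      = eval4 P2 (coords x y z w)"
    using chart_r2[OF assms] by blast
  let ?N = "total_degree P2"
  let ?p = "\<Sum>a\<le>?N. monom (\<Sum>b\<le>?N. (\<Sum>c\<le>?N. \<Sum>d\<le>?N. coeff4 P2 a b c d * z ^ c * w ^ d) * 0 ^ b) a"
  have "?K (1 / s) (tvar - w ^ 2 - cst \<alpha>2 * s) (z + 2 * w / s) w + 1 / s
      = poly ?p s" if "s \<noteq> 0" for s
  proof -
    have "?K (1 / s) (tvar - w ^ 2 - cst \<alpha>2 * s) (z + 2 * w / s) w + 1 / s
        = eval4 P2 (coords s 0 z w)"
      using P2[OF that, of w 0 z] by simp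
    also have "\<dots> = poly ?p s"
      unfolding eval4_coords[OF order_refl] poly_sum poly_monom sum_distrib_right
      by (intro sum.cong refl) (simp add: mult_ac)
    finally show ?thesis .
  qed
  then show ?thesis by blast
qed

section \<open>The Hamiltonian is determined up to a constant\<close>

lemma eval4_eq_0_imp_eq_0:
  fixes P :: "'k::field_char_0 poly4"
  assumes "\<And>x y z w. w \<noteq> 0 \<Longrightarrow> eval4 P (coords x y z w) = 0"
  shows "P = 0"
proof (rule poly_mapping_eqI)
  fix m
  let ?N = "total_degree P"
  have "coeff4 P a b c d = 0" for a b c d
  proof (cases "a + b + c + d \<le> ?N")
    case True
    have "(\<Sum>c\<le>?N. \<Sum>d\<le>?N. coeff4 P a b c d * z ^ c * w ^ d) = 0" if "w \<noteq> 0" for z w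
      by (rule sum_powers2_eqD[where h = "\<lambda>_ _. 0" and M = ?N and N = ?N])
        (use True assms[OF that] in \<open>auto simp: eval4_coords[OF order_refl, symmetric]\<close>)
    then have "(\<Sum>c\<le>?N. (\<Sum>d\<le>?N. coeff4 P a b c d * w ^ d) * z ^ c) = (\<Sum>c\<le>?N. 0 * z ^ c)"
      if "w \<noteq> 0" for z w
      using that by (simp add: sum_distrib_left mult_ac)
    from sum_powers_eqD[OF this] have "(\<Sum>d\<le>?N. coeff4 P a b c d * w ^ d) = 0" if "w \<noteq> 0" for w
      using that True by simp
    then have "poly (\<Sum>d\<le>?N. monom (coeff4 P a b c d) d) w = 0" if "w \<noteq> 0" for w
      using that by (simp add: poly_sum poly_monom)
    then have "(\<Sum>d\<le>?N. monom (coeff4 P a b c d) d) = 0"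
      by (rule poly_eq_0_off_zero)
    then have "coeff (\<Sum>d\<le>?N. monom (coeff4 P a b c d) d) d = 0"
      by simp
    with True show ?thesis
      by (simp add: coeff_sum)
  qed (simp add: coeff4_eq_0)
  then show "Poly_Mapping.lookup P m = Poly_Mapping.lookup 0 m"
    by (simp add: lookup_eq_coeff4[of P])
qed

lemma partial_superset:
  assumes "finite S" and "Poly_Mapping.keys p \<subseteq> S"
  shows "partial v p = (\<Sum>m\<in>S. Poly_Mapping.single (m - Poly_Mapping.single v 1)
           (of_nat (Poly_Mapping.lookup m v) * Poly_Mapping.lookup p m))"
  unfolding partial_def using assms by (intro sum.mono_neutral_left) (auto simp: in_keys_iff)

lemma partial_add: "partial v (p + q) = partial v p + partial v q"
proof -
  let ?S = "Poly_Mapping.keys p \<union> Poly_Mapping.keys q"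
  have "partial v r = (\<Sum>m\<in>?S. Poly_Mapping.single (m - Poly_Mapping.single v 1)
           (of_nat (Poly_Mapping.lookup m v) * Poly_Mapping.lookup r m))"
    if "Poly_Mapping.keys r \<subseteq> ?S" for r :: "'a poly4"
    by (rule partial_superset) (use that in auto)
  from this[of p] this[of q] this[of "p + q"] show ?thesis
    by (simp add: keys_add lookup_add distrib_left single_add sum.distrib)
qed

lemma partial_Const [simp]: "partial v (Const c) = 0"
  by (simp add: partial_def Const_def)

lemma ham_system_add_Const: "ham_system (H + Const c) = ham_system H"
  by (simp add: ham_system_def partial_add)

lemma cst_parameter_sum:
  assumes "\<alpha>0 + 2 * \<alpha>1 + 2 * \<alpha>2 + \<alpha>3 = 1"
  shows "cst \<alpha>0 + 2 * cst \<alpha>1 + 2 * cst \<alpha>2 + cst \<alpha>3 = 1"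
proof -
  have add: "cst a + cst b = cst (a + b)" for a b
    by (simp add: cst_def)
  have double: "2 * cst a = cst (2 * a)" for a
    by (simp only: mult_2 add)
  have "cst 1 = 1"
    by (simp add: cst_def One_fract_def one_pCons)
  then show ?thesis
    unfolding double add assms .
qed

lemma tvar_nonzero: "tvar \<noteq> 0"
  by (simp add: tvar_def Zero_fract_def eq_fract)

lemma ham_system_eq_hamH:
  assumes eq: "\<And>x y z w. w \<noteq> 0 \<Longrightarrow> tvar ^ 2 * (eval4 K (coords x y z w) - c) =
    x ^ 2 * y ^ 3 - (tvar * x + 2 * cst \<alpha>1 + cst \<alpha>2 + cst \<alpha>3) * x * y ^ 2
          - ((cst \<alpha>0 * tvar - 1) * x - cst \<alpha>1 * (cst \<alpha>1 + cst \<alpha>2 + cst \<alpha>3)) * y - tvar * x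
          - 1 / 4 * z ^ 2 * w ^ 4 + 1 / 2 * cst \<alpha>3 * z * w ^ 3
          + 1 / 4 * (2 * tvar * z ^ 2 - cst \<alpha>3 ^ 2) * w ^ 2
          - 1 / 2 * ((cst \<alpha>3 + 1) * tvar - 1) * z * w - 1 / 4 * tvar ^ 2 * z ^ 2
          + (x * y - cst \<alpha>1) * y * z * w"
  shows "ham_system K = ham_system (hamH \<alpha>0 \<alpha>1 \<alpha>2 \<alpha>3)"
proof -
  have "K - hamH \<alpha>0 \<alpha>1 \<alpha>2 \<alpha>3 - Const c = 0"
  proof (rule eval4_eq_0_imp_eq_0)
    fix x y z w :: ratt
    assume w: "w \<noteq> 0"
    have "eval4 (hamH \<alpha>0 \<alpha>1 \<alpha>2 \<alpha>3) (coords x y z w)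
        = 1 / tvar ^ 2 * (tvar ^ 2 * (eval4 K (coords x y z w) - c))"
      unfolding eq[OF w]
      by (simp only: hamH_def Let_def eval4_mult eval4_add eval4_minus eval4_power
          eval4_Const eval4_Var eval4_numeral eval4_1 coords_simps)
    then show "eval4 (K - hamH \<alpha>0 \<alpha>1 \<alpha>2 \<alpha>3 - Const c) (coords x y z w) = 0"
      using tvar_nonzero by simp
  qed
  then have "K = hamH \<alpha>0 \<alpha>1 \<alpha>2 \<alpha>3 + Const c"
    by (simp add: algebra_simps)
  then show ?thesis
    by (metis ham_system_add_Const)
qed

theorem theorem3p5:
  fixes \<alpha>0 \<alpha>1 \<alpha>2 \<alpha>3 :: complex
    and K :: "complex poly fract poly4"
  assumes "\<alpha>0 + 2 * \<alpha>1 + 2 * \<alpha>2 + \<alpha>3 = 1"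
    and "total_degree K = 6"
    and "polynomial_in_coords K (r0 \<alpha>0)"
    and "polynomial_in_coords K (r1 \<alpha>1)"
    and "polynomial_in_coords (K + Var VX) (r2 \<alpha>2)"
    and "polynomial_in_coords K (r3 \<alpha>3)"
  shows "ham_system K = ham_system (hamH \<alpha>0 \<alpha>1 \<alpha>2 \<alpha>3)"
proof (rule ham_system_eq_hamH)
  fix x y z w :: ratt
  assume w: "w \<noteq> 0"
  have "total_degree K \<le> 6"
    using assms(2) by simp
  note form = normal_form[OF this assms(3,4,6)]
  show "tvar ^ 2 * (eval4 K (coords x y z w) - coeff4 K 0 0 0 0) =
    x ^ 2 * y ^ 3 - (tvar * x + 2 * cst \<alpha>1 + cst \<alpha>2 + cst \<alpha>3) * x * y ^ 2
          - ((cst \<alpha>0 * tvar - 1) * x - cst \<alpha>1 * (cst \<alpha>1 + cst \<alpha>2 + cst \<alpha>3)) * y - tvar * x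
          - 1 / 4 * z ^ 2 * w ^ 4 + 1 / 2 * cst \<alpha>3 * z * w ^ 3
          + 1 / 4 * (2 * tvar * z ^ 2 - cst \<alpha>3 ^ 2) * w ^ 2
          - 1 / 2 * ((cst \<alpha>3 + 1) * tvar - 1) * z * w - 1 / 4 * tvar ^ 2 * z ^ 2
          + (x * y - cst \<alpha>1) * y * z * w"
    by (rule r2_chart_determines[where K = "\<lambda>x y z w. eval4 K (coords x y z w)",
          OF tvar_nonzero cst_parameter_sum[OF assms(1)] polynomial_on_r2_curves[OF assms(5)] form w])
qed

end
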